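(* Let $0<a<b$ and $P\in\mathcal C^2_\psi(\Omega)$ with $a\le P(\omega)\le b$ for all $\omega\in\Omega$. For $\omega\in\Omega$ let $p_\omega(t)=P(\omega+\psi(t))$, $t\in\mathbb R$, and let $v_*=2\max\{\max_{\varpi\in\Omega}\partial_\psi P(\varpi),0\}$. Let $E_\omega$ be the escaping set of the ping-pong map with forcing $p=p_\omega$, i.e. the set of $(t_0,v_0)\in\mathbb R\times(v_*,\infty)$ for which the whole forward orbit $(t_n,v_n)_{n\in\mathbb N}$ is well defined (all $v_n>v_*$) and $\lim_{n\to\infty}v_n=\infty$. Then for $\mu_\Omega$-almost every $\omega\in\Omega$ the set $E_\omega\subset\mathbb R^2$ has Lebesgue measure zero.
   Context: $\Omega$ is a commutative (written additively), compact, metrizable topological group, and $\psi:\mathbb R\to\Omega$ is a continuous group homomorphism with $\psi(\mathbb R)$ dense; $\mu_\Omega$ is its Haar probability measure. For $U:\Omega\to\mathbb R$, $\partial_\psi U(\omega)=\lim_{t\to0}\frac{U(\omega+\psi(t))-U(\omega)}{t}$; $\mathcal C^2_\psi(\Omega)$ is the space of continuous $U$ such that $\partial_\psi U$ and $\partial_\psi^2U=\partial_\psi(\partial_\psi U)$ exist everywhere and are continuous on $\Omega$. Ping-pong map: for a forcing $p\in\mathcal C^2(\mathbb R)$ with $0<a\le p\le b$ and bounded $\dot p,\ddot p$, and $v_0>v_*:=2\max\{\sup_t\dot p(t),0\}$, the map $(t_0,v_0)\mapsto(t_1,v_1)$ is defined by letting $\tilde t$ be the unique solution of $(\tilde t-t_0)v_0=p(\tilde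 t)$ and setting $v_1=v_0-2\dot p(\tilde t)$, $t_1=\tilde t+p(\tilde t)/v_1$. (It describes a particle bouncing elastically between a fixed wall at $x=0$ and a moving wall at $x=p(t)$; $t_n,v_n$ are the times and post-impact velocities of successive impacts at $x=0$.) Orbits are $(t_n,v_n)$ obtained by iterating this map as long as $v_n>v_*$. *)

theory Defs
  imports "HOL-Analysis.Analysis" "HOL-Probability.Probability"
begin

(* Haar probability measure on a compact commutative group 'a:
   a translation-invariant Borel probability measure (unique on compact groups). *)
definition haar_prob :: "'a::{topological_ab_group_add, metric_space} measure \<Rightarrow> bool" where
  "haar_prob \<mu> \<longleftrightarrow> prob_space \<mu> \<and> sets \<mu> = sets borel \<and>
     (\<forall>c A. A \<in> sets borel \<longrightarrow> measure \<mu> ((\<lambda>x. c + x) ` A) = measure \<mu> A)"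

definition has_dpsi :: "(real \<Rightarrow> 'a::topological_ab_group_add) \<Rightarrow> ('a \<Rightarrow> real) \<Rightarrow> real \<Rightarrow> 'a \<Rightarrow> bool" where
  "has_dpsi \<psi> U D \<omega> \<longleftrightarrow> ((\<lambda>t. (U (\<omega> + \<psi> t) - U \<omega>) / t) \<longlongrightarrow> D) (at 0)"

definition dpsi :: "(real \<Rightarrow> 'a::topological_ab_group_add) \<Rightarrow> ('a \<Rightarrow> real) \<Rightarrow> 'a \<Rightarrow> real" where
  "dpsi \<psi> U \<omega> = (THE D. has_dpsi \<psi> U D \<omega>)"

definition C2_psi :: "(real \<Rightarrow> 'a::topological_ab_group_add) \<Rightarrow> ('a \<Rightarrow> real) \<Rightarrow> bool" where
  "C2_psi \<psi> U \<longleftrightarrow> continuous_on UNIV U \<and>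
     (\<forall>\<omega>. \<exists>D. has_dpsi \<psi> U D \<omega>) \<and> continuous_on UNIV (dpsi \<psi> U) \<and>
     (\<forall>\<omega>. \<exists>D. has_dpsi \<psi> (dpsi \<psi> U) D \<omega>) \<and> continuous_on UNIV (dpsi \<psi> (dpsi \<psi> U))"

definition pp_tilde :: "(real \<Rightarrow> real) \<Rightarrow> real \<Rightarrow> real \<Rightarrow> real" where
  "pp_tilde p t0 v0 = (THE s. (s - t0) * v0 = p s)"

definition pp_map :: "(real \<Rightarrow> real) \<Rightarrow> real \<times> real \<Rightarrow> real \<times> real" where
  "pp_map p tv = (let t0 = fst tv; v0 = snd tv; s = pp_tilde p t0 v0;
                      v1 = v0 - 2 * deriv p s
                  in (s + p s / v1, v1))"

definition pp_orbit :: "(real \<Rightarrow> real) \<Rightarrow> real \<times> real \<Rightarrow> nat \<Rightarrow> real \<times> real" where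
  "pp_orbit p tv n = (pp_map p ^^ n) tv"

definition escaping_set :: "(real \<Rightarrow> real) \<Rightarrow> real \<Rightarrow> (real \<times> real) set" where
  "escaping_set p vs = {tv. snd tv > vs \<and> (\<forall>n. snd (pp_orbit p tv n) > vs) \<and>
      filterlim (\<lambda>n. snd (pp_orbit p tv n)) at_top sequentially}"

end

theory Submission
  imports Defs
begin

text \<open>
  Following the phase \<open>\<omega> + \<psi> t\<close> instead of the time \<open>t\<close> turns the ping-pong maps of all
  forcings into a single map of \<open>\<Omega> \<times> \<real>\<close>, and averaging along the flow shows that
  it preserves \<open>v dv d\<mu>\<close> at high speed. The adiabatic invariant \<open>P \<omega> * v\<close> changes by only
  \<open>o(1/v)\<close> per step, so an orbit whose invariant rises past a level \<open>c\<close> has to enter a band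
  below \<open>c\<close> whose measure tends to \<open>0\<close> as \<open>c\<close> grows. The set of last visits of escaping
  orbits to a sublevel set of the invariant is wandering, and each of its points later enters every
  such band; hence it is at most as large as the band, that is, null. Preimages of these sets exhaust the
  escaping set, and Fubini with the translation invariance of \<open>\<mu>\<close> gives almost every single forcing.
\<close>

text \<open>The rate o(1/v) is what makes it narrow enough: near the level \<open>c\<close> the
  speed is of order \<open>c\<close> and enters the measure as a weight, so a band of width w has
  measure of order c * w. A change of O(1/v) per step would only keep this product bounded; the
  uniform continuity of \<open>P''\<close> over short flights makes the constant arbitrarily small.
  The second obstacle is the range of speeds between \<open>v_star\<close> and
  \<open>2 * speed_bound\<close>. Above \<open>v_star\<close> the flight to the moving wall is well
  behaved, but the time change of the return flight has derivative 1 + P' / v, which is negative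
  where the wall approaches fast enough. The map may fold there, so the wandering argument is run
  only above \<open>2 * speed_bound\<close>, and the slower part of an orbit is handled by pulling
  back null sets, which survives folding.\<close>

section \<open>Wandering sets\<close>

text \<open>Divide by T and let T tend to infinity. It removes the boundary error K that remains
  after averaging over a time window of length T.\<close>

lemma ennreal_le_if_scaled_le:
  fixes x y :: ennreal and K :: real
  assumes le: "\<And>T. T > 0 \<Longrightarrow> ennreal T * x \<le> ennreal (T + K) * y" and K: "K \<ge> 0"
  shows "x \<le> y"
proof (cases y)
  case (real r)
  have "x \<le> ennreal (1 + K) * y" using le[of 1] by simp
  also have "\<dots> < \<top>" using real by (simp add: ennreal_mult_less_top)
  finally obtain q where q: "x = ennreal q" "q \<ge> 0" by (cases x) auto
  have *: "T * q \<le> (T + K) * r" if "T > 0" for T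
    using le[OF that] that K q real by (simp add: ennreal_mult[symmetric] del: ennreal_plus)
  have "q \<le> r"
  proof (rule ccontr)
    assume "\<not> q \<le> r"
    then have d: "q - r > 0" by simp
    \<comment> \<open>Chosen so that T * (q - r) exceeds K * r by exactly q - r.\<close>
    define T where "T = K * r / (q - r) + 1"
    have "T > 0" using d K real(1) by (simp add: T_def add_nonneg_pos)
    from *[OF this] have "T * (q - r) \<le> K * r" by (simp add: algebra_simps)
    moreover have "T * (q - r) = K * r + (q - r)" using d by (simp add: T_def field_simps)
    ultimately show False using d by simp
  qed
  then show ?thesis using q real by (simp add: ennreal_leI)
qed simp

text \<open>Pull \<open>B\<close> back step by step, each time discarding the part lying in
  \<open>Z\<close>. Pulling back does not increase mass, so the discarded pieces together weigh at
  most as much as \<open>B\<close>, and because \<open>Z\<close> is wandering these pieces cover it.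
  Neither invertibility of \<open>F\<close> nor finiteness of the measure enters.\<close>

lemma emeasure_wandering_le:
  assumes F[measurable]: "F \<in> M \<rightarrow>\<^sub>M M" and E[measurable]: "E \<in> sets M"
    and F_E: "\<And>x. x \<in> E \<Longrightarrow> F x \<in> E"
    and sub: "\<And>B. B \<in> sets M \<Longrightarrow> B \<subseteq> E \<Longrightarrow> emeasure M (E \<inter> F -` B) \<le> emeasure M B"
    and Z[measurable]: "Z \<in> sets M" "Z \<subseteq> E"
    and wandering: "\<And>x n. x \<in> Z \<Longrightarrow> n > 0 \<Longrightarrow> (F ^^ n) x \<notin> Z"
    and B[measurable]: "B \<in> sets M" "B \<subseteq> E"
    and hit: "\<And>x. x \<in> Z \<Longrightarrow> \<exists>n. (F ^^ n) x \<in> B"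
  shows "emeasure M Z \<le> emeasure M B"
proof -
  have vimage: "E \<inter> F -` C \<in> sets M" if "C \<in> sets M" for C
  proof -
    have "E \<inter> F -` C = E \<inter> (F -` C \<inter> space M)" using sets.sets_into_space[OF E] by auto
    then show ?thesis using measurable_sets[OF F that] E by simp
  qed
  \<comment> \<open>\<open>C n\<close> consists of the points of \<open>E\<close> that are in
    \<open>B\<close> after n steps and avoid \<open>Z\<close> at the times 1 to n; at time 0 they
    may lie in \<open>Z\<close>.\<close>
  define C where "C = rec_nat B (\<lambda>_ C. E \<inter> F -` (C - Z))"
  have C0: "C 0 = B" and CS: "\<And>n. C (Suc n) = E \<inter> F -` (C n - Z)" by (simp_all add: C_def)
  have C_sets[measurable]: "C n \<in> sets M" for n
    by (induction n) (auto simp: C0 CS B intro!: vimage)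
  have C_E: "C n \<subseteq> E" for n by (cases n) (auto simp: C0 CS B(2) B(2)[THEN subsetD])
  \<comment> \<open>Mass balance: what has been discarded so far plus what is still being pulled
    back.\<close>
  have bound: "(\<Sum>i<n. emeasure M (C i \<inter> Z)) + emeasure M (C n) \<le> emeasure M B" for n
  proof (induction n)
    case 0 show ?case by (simp add: C0)
  next
    case (Suc n)
    have "emeasure M (C (Suc n)) \<le> emeasure M (C n - Z)"
      unfolding CS using C_E by (intro sub) auto
    moreover have "emeasure M (C n) = emeasure M (C n \<inter> Z) + emeasure M (C n - Z)"
      by (subst plus_emeasure) (auto intro!: arg_cong[where f="emeasure M"])
    ultimately have "(\<Sum>i<Suc n. emeasure M (C i \<inter> Z)) + emeasure M (C (Suc n))
        \<le> (\<Sum>i<n. emeasure M (C i \<inter> Z)) + emeasure M (C n)"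
      by (simp add: add.assoc add_left_mono)
    with Suc show ?case by order
  qed
  have iterate_E: "(F ^^ n) x \<in> E" if "x \<in> E" for n x
    by (induction n) (auto simp: that F_E)
  \<comment> \<open>Runs along the orbit backwards from the hit of \<open>B\<close>; the case i = n
    puts the starting point itself into \<open>C n\<close>.\<close>
  have reach: "(F ^^ (n - i)) x \<in> C i" if "x \<in> Z" "(F ^^ n) x \<in> B" "i \<le> n" for x n i
    using that(3)
  proof (induction i)
    case 0 then show ?case using that by (simp add: C0)
  next
    case (Suc i)
    have eq: "F ((F ^^ (n - Suc i)) x) = (F ^^ (n - i)) x"
      using Suc.prems by (metis Suc_diff_Suc Suc_le_lessD funpow.simps(2) o_apply)
    have "(F ^^ (n - i)) x \<notin> Z" using that(1) Suc.prems by (intro wandering) auto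
    moreover have "(F ^^ (n - i)) x \<in> C i" using Suc by simp
    ultimately show ?case using iterate_E that(1) Z(2) by (auto simp: CS eq)
  qed
  have "Z \<subseteq> (\<Union>i. C i \<inter> Z)"
  proof
    fix x assume x: "x \<in> Z"
    with hit obtain n where "(F ^^ n) x \<in> B" by blast
    from reach[OF x this order_refl] x show "x \<in> (\<Union>i. C i \<inter> Z)" by auto
  qed
  then have "emeasure M Z \<le> emeasure M (\<Union>i. C i \<inter> Z)" by (intro emeasure_mono) auto
  also have "\<dots> \<le> (\<Sum>i. emeasure M (C i \<inter> Z))" by (intro emeasure_subadditive_countably) auto
  also have "\<dots> \<le> emeasure M B"
  proof (intro suminf_le_const)
    fix n show "(\<Sum>i<n. emeasure M (C i \<inter> Z)) \<le> emeasure M B"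
      using bound[of n] le_add_same_cancel1 by (meson add_increasing2 order_trans order_refl zero_le)
  qed auto
  finally show ?thesis .
qed

section \<open>Change of variables along the flow\<close>

lemma has_dpsi_dpsi:
  assumes "\<exists>D. has_dpsi \<psi> U D \<omega>"
  shows "has_dpsi \<psi> U (dpsi \<psi> U \<omega>) \<omega>"
proof -
  obtain D where D: "has_dpsi \<psi> U D \<omega>" using assms by blast
  then have "dpsi \<psi> U \<omega> = D"
    unfolding dpsi_def has_dpsi_def
    by (intro the_equality) (auto intro: tendsto_unique[OF trivial_limit_at])
  with D show ?thesis by simp
qed

locale compact_flow =
  fixes \<psi> :: "real \<Rightarrow> 'a::{topological_ab_group_add, metric_space}"
    and \<mu> :: "'a measure"
  assumes compact_Omega: "compact (UNIV :: 'a set)"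
    and psi_cont: "continuous_on UNIV \<psi>"
    and psi_add: "\<psi> (s + t) = \<psi> s + \<psi> t"
    and haar: "haar_prob \<mu>"
begin

lemma psi_0 [simp]: "\<psi> 0 = 0"
  using psi_add[of 0 0] by simp

lemma psi_minus: "\<psi> (- t) = - \<psi> t"
  using psi_add[of t "- t"] by (simp add: eq_neg_iff_add_eq_0 add.commute)

sublocale prob_space \<mu>
  using haar by (simp add: haar_prob_def)

lemma sets_mu [measurable_cong]: "sets \<mu> = sets borel"
  using haar by (simp add: haar_prob_def)

lemma space_mu [simp]: "space \<mu> = UNIV"
  using sets_eq_imp_space_eq[OF sets_mu] by simp

sublocale mu_lborel: pair_sigma_finite \<mu> "lborel :: real measure" ..

lemma continuous_on_psi [continuous_intros]:
  "continuous_on A f \<Longrightarrow> continuous_on A (\<lambda>x. \<psi> (f x))"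
  using continuous_on_compose2[OF psi_cont] by blast

lemma tendsto_psi [tendsto_intros]: "(f \<longlongrightarrow> l) F \<Longrightarrow> ((\<lambda>x. \<psi> (f x)) \<longlongrightarrow> \<psi> l) F"
  by (rule continuous_on_tendsto_compose[OF psi_cont]) auto

text \<open>The type of \<open>\<Omega>\<close> is not of class \<open>second_countable_topology\<close>, so
  joint measurability cannot be read off from continuity.\<close>
lemma measurable_flow [measurable]:
  assumes [measurable]: "f \<in> borel_measurable M" "g \<in> borel_measurable M"
  shows "(\<lambda>x. f x + \<psi> (g x)) \<in> borel_measurable M"
proof (rule borel_measurable_LIMSEQ_metric)
  fix n :: nat
  have shift[measurable]: "(\<lambda>\<omega>. \<omega> + \<psi> t) \<in> borel_measurable borel" for t
    by (intro borel_measurable_continuous_onI continuous_intros)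
  have "(\<lambda>x. f x + \<psi> (real_of_int i / real (Suc n))) \<in> borel_measurable M" for i
    by measurable
  \<comment> \<open>\<open>g\<close> is rounded down to the grid of mesh 1 / (n + 1), so only
    countably many translations occur, each of them continuous.\<close>
  then show "(\<lambda>x. f x + \<psi> (real_of_int \<lfloor>g x * real (Suc n)\<rfloor> / real (Suc n))) \<in> borel_measurable M"
    by (rule measurable_compose_countable[where g="\<lambda>x. \<lfloor>g x * real (Suc n)\<rfloor>"]) measurable
next
  fix x
  have "(\<lambda>n. real_of_int \<lfloor>g x * real (Suc n)\<rfloor> / real (Suc n)) \<longlonglongrightarrow> g x"
  proof (rule tendsto_sandwich)
    show "\<forall>\<^sub>F n in sequentially. g x - 1 / real (Suc n) \<le> real_of_int \<lfloor>g x * real (Suc n)\<rfloor> / real (Suc n)"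
    proof (intro always_eventually allI)
      fix n
      have "g x * real (Suc n) - 1 \<le> of_int \<lfloor>g x * real (Suc n)\<rfloor>" by linarith
      then have "(g x * real (Suc n) - 1) / real (Suc n) \<le> of_int \<lfloor>g x * real (Suc n)\<rfloor> / real (Suc n)"
        by (intro divide_right_mono) auto
      moreover have "(g x * real (Suc n) - 1) / real (Suc n) = g x - 1 / real (Suc n)"
        by (simp add: diff_divide_distrib del: of_nat_Suc)
      ultimately show "g x - 1 / real (Suc n) \<le> of_int \<lfloor>g x * real (Suc n)\<rfloor> / real (Suc n)"
        by simp
    qed
    show "\<forall>\<^sub>F n in sequentially. real_of_int \<lfloor>g x * real (Suc n)\<rfloor> / real (Suc n) \<le> g x"
    proof (intro always_eventually allI)
      fix n
      have "of_int \<lfloor>g x * real (Suc n)\<rfloor> \<le> g x * real (Suc n)" by linarith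
      then show "of_int \<lfloor>g x * real (Suc n)\<rfloor> / real (Suc n) \<le> g x"
        by (simp add: field_simps)
    qed
    have "(\<lambda>n. g x - 1 / real (Suc n)) \<longlonglongrightarrow> g x - 0"
      by (intro tendsto_diff tendsto_const LIMSEQ_Suc[OF lim_1_over_n])
    then show "(\<lambda>n. g x - 1 / real (Suc n)) \<longlonglongrightarrow> g x" by simp
  qed simp
  then show "(\<lambda>n. f x + \<psi> (real_of_int \<lfloor>g x * real (Suc n)\<rfloor> / real (Suc n))) \<longlonglongrightarrow> f x + \<psi> (g x)"
    by (intro tendsto_intros)
qed

section \<open>Invariance of the Haar measure and averages along orbits\<close>

lemma nn_integral_translate:
  assumes [measurable]: "g \<in> borel_measurable borel"
  shows "(\<integral>\<^sup>+\<omega>. g (\<omega> + c) \<partial>\<mu>) = (\<integral>\<^sup>+\<omega>. g \<omega> \<partial>\<mu>)"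
proof -
  have [measurable]: "(\<lambda>\<omega>. \<omega> + c) \<in> borel_measurable borel"
    by (intro borel_measurable_continuous_onI continuous_intros)
  have "distr \<mu> \<mu> (\<lambda>\<omega>. \<omega> + c) = \<mu>"
  proof (rule measure_eqI)
    fix A assume "A \<in> sets (distr \<mu> \<mu> (\<lambda>\<omega>. \<omega> + c))"
    then have A[measurable]: "A \<in> sets borel" by (simp add: sets_mu)
    have "(\<lambda>\<omega>. \<omega> + c) -` A = (\<lambda>x. - c + x) ` A"
      by (auto simp: image_iff algebra_simps intro!: bexI[where x="_ + c"])
    then have "measure \<mu> ((\<lambda>\<omega>. \<omega> + c) -` A) = measure \<mu> A"
      using haar A unfolding haar_prob_def by metis
    then show "emeasure (distr \<mu> \<mu> (\<lambda>\<omega>. \<omega> + c)) A = emeasure \<mu> A"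
      by (subst emeasure_distr) (auto simp: emeasure_eq_measure)
  qed simp
  then have "(\<integral>\<^sup>+\<omega>. g \<omega> \<partial>\<mu>) = (\<integral>\<^sup>+\<omega>. g \<omega> \<partial>distr \<mu> \<mu> (\<lambda>\<omega>. \<omega> + c))" by simp
  also have "\<dots> = (\<integral>\<^sup>+\<omega>. g (\<omega> + c) \<partial>\<mu>)" by (rule nn_integral_distr) auto
  finally show ?thesis by simp
qed

text \<open>Fubini, with translation invariance applied at each fixed t. It converts between
  integrals over the group and integrals along single flow lines, where one-dimensional calculus is
  available.\<close>

lemma nn_integral_flow_average:
  assumes [measurable]: "g \<in> borel_measurable borel" "A \<in> sets borel"
  shows "(\<integral>\<^sup>+\<omega>. (\<integral>\<^sup>+t. g (\<omega> + \<psi> t) * indicator A t \<partial>lborel) \<partial>\<mu>)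
    = emeasure lborel A * (\<integral>\<^sup>+\<omega>. g \<omega> \<partial>\<mu>)"
proof -
  have "(\<integral>\<^sup>+\<omega>. (\<integral>\<^sup>+t. g (\<omega> + \<psi> t) * indicator A t \<partial>lborel) \<partial>\<mu>)
      = (\<integral>\<^sup>+t. (\<integral>\<^sup>+\<omega>. g (\<omega> + \<psi> t) * indicator A t \<partial>\<mu>) \<partial>lborel)"
    by (rule mu_lborel.Fubini'[symmetric]) measurable
  also have "\<dots> = (\<integral>\<^sup>+t. (\<integral>\<^sup>+\<omega>. g \<omega> \<partial>\<mu>) * indicator A t \<partial>lborel)"
    by (intro nn_integral_cong) (simp add: nn_integral_multc nn_integral_translate)
  also have "\<dots> = emeasure lborel A * (\<integral>\<^sup>+\<omega>. g \<omega> \<partial>\<mu>)"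
    by (subst nn_integral_cmult_indicator) (auto simp: mult.commute)
  finally show ?thesis .
qed

lemma has_dpsi_imp_deriv:
  assumes "has_dpsi \<psi> U D (\<omega> + \<psi> t)"
  shows "((\<lambda>t. U (\<omega> + \<psi> t)) has_real_derivative D) (at t)"
  using assms by (simp add: has_dpsi_def DERIV_def psi_add add.assoc)

section \<open>Moving each phase along its flow line by a phase-dependent time\<close>

context
  fixes s s' :: "'a \<Rightarrow> real"
  assumes s: "\<And>\<omega>. has_dpsi \<psi> s (s' \<omega>) \<omega>"
    and s_cont: "continuous_on UNIV s" and s'_cont: "continuous_on UNIV s'"
begin

lemma deriv_shifted_time:
  "((\<lambda>t. t + s (\<omega> + \<psi> t)) has_real_derivative 1 + s' (\<omega> + \<psi> t)) (at t)"
  by (intro derivative_intros has_dpsi_imp_deriv s)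

lemma continuous_on_deriv_shifted_time: "continuous_on A (\<lambda>t. 1 + s' (\<omega> + \<psi> t))"
  by (intro continuous_intros continuous_on_compose2[OF s'_cont]) auto

text \<open>Along a flow line \<open>\<omega> \<mapsto> \<omega> + \<psi> (s \<omega>)\<close> is the time change
  \<open>t \<mapsto> t + s (\<omega> + \<psi> t)\<close>, so on a time window of length \<open>T\<close> the one-dimensional
  substitution rule holds up to boundary terms that do not depend on \<open>T\<close>.\<close>
lemma nn_integral_flow_shift:
  assumes g[measurable]: "g \<in> borel_measurable borel" and nonneg: "\<And>\<omega>. 1 + s' \<omega> \<ge> 0"
  shows "(\<integral>\<^sup>+\<omega>. g (\<omega> + \<psi> (s \<omega>)) * ennreal (1 + s' \<omega>) \<partial>\<mu>) = (\<integral>\<^sup>+\<omega>. g \<omega> \<partial>\<mu>)" (is "?L = ?R")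
proof -
  have [measurable]: "s \<in> borel_measurable borel" "s' \<in> borel_measurable borel"
    using s_cont s'_cont by (auto intro: borel_measurable_continuous_onI)
  have "bounded (range s)"
    using compact_continuous_image[OF s_cont compact_Omega] by (rule compact_imp_bounded)
  then obtain K where K: "\<And>\<omega>. \<bar>s \<omega>\<bar> \<le> K" by (auto simp: bounded_iff)
  then have K0: "K \<ge> 0" by (meson abs_ge_zero order_trans)
  define G where "G \<omega> = g (\<omega> + \<psi> (s \<omega>)) * ennreal (1 + s' \<omega>)" for \<omega>
  have G[measurable]: "G \<in> borel_measurable borel" unfolding G_def by measurable
  define I where "I A \<omega> = (\<integral>\<^sup>+t. g (\<omega> + \<psi> t) * indicator A t \<partial>lborel)" for A \<omega>
  have I_int: "(\<integral>\<^sup>+\<omega>. I {x..y} \<omega> \<partial>\<mu>) = ennreal (y - x) * ?R" if "x \<le> y" for x y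
    unfolding I_def by (subst nn_integral_flow_average) (use that in auto)
  have I_meas[measurable]: "I {x..y} \<in> borel_measurable borel" for x y
    unfolding I_def by measurable
  have I_mono: "I A \<omega> \<le> I B \<omega>" if "A \<subseteq> B" for A B \<omega>
    unfolding I_def using that by (intro nn_integral_mono) (auto split: split_indicator)
  have window: "(\<integral>\<^sup>+t. G (\<omega> + \<psi> t) * indicator {0..T} t \<partial>lborel) = I {s \<omega>..T + s (\<omega> + \<psi> T)} \<omega>"
    if "T > 0" for \<omega> T
  proof -
    have "(\<integral>\<^sup>+t. g (\<omega> + \<psi> t) * indicator {0 + s (\<omega> + \<psi> 0)..T + s (\<omega> + \<psi> T)} t \<partial>lborel)
      = (\<integral>\<^sup>+t. g (\<omega> + \<psi> (t + s (\<omega> + \<psi> t))) * ennreal (1 + s' (\<omega> + \<psi> t)) * indicator {0..T} t \<partial>lborel)"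
      by (rule nn_integral_substitution_aux[where f="\<lambda>t. g (\<omega> + \<psi> t)"])
         (use that nonneg in \<open>auto intro: deriv_shifted_time continuous_on_deriv_shifted_time\<close>)
    then show ?thesis by (simp add: G_def I_def psi_add add.assoc)
  qed
  have L: "(\<integral>\<^sup>+\<omega>. I {s \<omega>..T + s (\<omega> + \<psi> T)} \<omega> \<partial>\<mu>) = ennreal T * ?L" if "T > 0" for T
  proof -
    have "(\<integral>\<^sup>+\<omega>. I {s \<omega>..T + s (\<omega> + \<psi> T)} \<omega> \<partial>\<mu>)
        = (\<integral>\<^sup>+\<omega>. (\<integral>\<^sup>+t. G (\<omega> + \<psi> t) * indicator {0..T} t \<partial>lborel) \<partial>\<mu>)"
      using window[OF that] by simp
    also have "\<dots> = ennreal T * (\<integral>\<^sup>+\<omega>. G \<omega> \<partial>\<mu>)"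
      by (subst nn_integral_flow_average) (use that in auto)
    finally show ?thesis by (simp add: G_def)
  qed
  have abs: "- K \<le> s \<omega>" "s \<omega> \<le> K" for \<omega> using K[of \<omega>] by auto
  \<comment> \<open>Every shifted window lies in \<open>{- K..T + K}\<close>, of length T + 2 *
    K.\<close>
  have "?L \<le> ?R"
  proof (rule ennreal_le_if_scaled_le[where K="2 * K"])
    fix T :: real assume T: "T > 0"
    have "ennreal T * ?L \<le> (\<integral>\<^sup>+\<omega>. I {- K..T + K} \<omega> \<partial>\<mu>)"
      unfolding L[OF T, symmetric] using abs by (intro nn_integral_mono I_mono) auto
    then show "ennreal T * ?L \<le> ennreal (T + 2 * K) * ?R"
      using I_int[of "- K" "T + K"] T K0 by (simp add: algebra_simps)
  qed (use K0 in auto)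
  moreover have "?R \<le> ?L"
  proof (rule ennreal_le_if_scaled_le[where K="2 * K"])
    fix T :: real assume T: "T > 0"
    have "(\<integral>\<^sup>+\<omega>. I {K..T + K} \<omega> \<partial>\<mu>) \<le> ennreal (T + 2 * K) * ?L"
    proof (subst L[symmetric])
      \<comment> \<open>The window is lengthened to T + 2 * K beforehand so that its shifted image
        still contains an interval of length T.\<close>
      have "{K..T + K} \<subseteq> {s \<omega>..T + 2 * K + s (\<omega> + \<psi> (T + 2 * K))}" for \<omega>
        using abs(2)[of \<omega>] abs(1)[of "\<omega> + \<psi> (T + 2 * K)"] by auto
      then show "(\<integral>\<^sup>+\<omega>. I {K..T + K} \<omega> \<partial>\<mu>)
          \<le> (\<integral>\<^sup>+\<omega>. I {s \<omega>..T + 2 * K + s (\<omega> + \<psi> (T + 2 * K))} \<omega> \<partial>\<mu>)"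
        by (intro nn_integral_mono I_mono)
    qed (use T K0 in auto)
    then show "ennreal T * ?R \<le> ennreal (T + 2 * K) * ?L"
      using I_int[of K "T + K"] T by simp
  qed (use K0 in auto)
  ultimately show ?thesis by (rule antisym)
qed

text \<open>Here 1 + s' may change sign, so the integral formula above does not apply. Almost every
  flow line meets \<open>N\<close> in a null set of times; on an interval where the time change has
  positive derivative, such a set has null preimage. Averaging over a time window returns from flow
  lines to \<open>\<mu>\<close>.\<close>

lemma AE_flow_shift:
  assumes N: "N \<in> null_sets \<mu>"
  shows "AE \<omega> in \<mu>. 1 + s' \<omega> > 0 \<longrightarrow> \<omega> + \<psi> (s \<omega>) \<notin> N"
proof -
  have [measurable]: "s \<in> borel_measurable borel" "s' \<in> borel_measurable borel"
    using s_cont s'_cont by (auto intro: borel_measurable_continuous_onI)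
  have N'[measurable]: "N \<in> sets borel" using N by (auto simp: sets_mu)
  define C where "C = {\<omega>. 1 + s' \<omega> > 0 \<and> \<omega> + \<psi> (s \<omega>) \<in> N}"
  have C[measurable]: "C \<in> sets borel" unfolding C_def by measurable
  \<comment> \<open>The window is the whole time axis; its infinite length is harmless since
    infinity * 0 = 0 in \<open>ennreal\<close>.\<close>
  have "(\<integral>\<^sup>+\<omega>. (\<integral>\<^sup>+t. indicator N (\<omega> + \<psi> t) * indicator UNIV t \<partial>lborel) \<partial>\<mu>) = 0"
    using N by (subst nn_integral_flow_average) (auto simp: null_setsD1)
  then have "AE \<omega> in \<mu>. (\<integral>\<^sup>+t. indicator N (\<omega> + \<psi> t) * indicator UNIV t \<partial>lborel) = 0"
    by (subst (asm) nn_integral_0_iff_AE) auto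
  then have "AE \<omega> in \<mu>. (\<integral>\<^sup>+t. indicator C (\<omega> + \<psi> t) * indicator {0..1} t \<partial>lborel) = 0"
  proof eventually_elim
    fix \<omega>
    assume N0: "(\<integral>\<^sup>+t. indicator N (\<omega> + \<psi> t) * indicator UNIV t \<partial>(lborel :: real measure)) = 0"
    define \<sigma> where "\<sigma> t = t + s (\<omega> + \<psi> t)" for t
    have [measurable]: "\<sigma> \<in> borel_measurable borel" unfolding \<sigma>_def by measurable
    \<comment> \<open>Rational endpoints make the family countable, so the null sets of the single
      intervals can be united; by continuity of s' the intervals cover every time at which 1 + s' is
      positive.\<close>
    define J where "J = {(p, q). p \<in> \<rat> \<and> q \<in> \<rat> \<and> p < q \<and> (\<forall>t\<in>{p..q}. 1 + s' (\<omega> + \<psi> t) > 0)}"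
    have "countable (\<rat> \<times> \<rat> :: (real \<times> real) set)" by (intro countable_SIGMA countable_rat)
    then have J: "countable J" by (rule countable_subset[rotated]) (auto simp: J_def)
    have "AE t in lborel. \<forall>(p, q)\<in>J. t \<in> {p..q} \<longrightarrow> \<omega> + \<psi> (\<sigma> t) \<notin> N"
    proof (subst AE_ball_countable[OF J], safe)
      fix p q assume pq: "(p, q) \<in> J"
      have "(\<integral>\<^sup>+t. indicator N (\<omega> + \<psi> (\<sigma> t)) * ennreal (1 + s' (\<omega> + \<psi> t)) * indicator {p..q} t \<partial>lborel)
        = (\<integral>\<^sup>+t. indicator N (\<omega> + \<psi> t) * indicator {\<sigma> p..\<sigma> q} t \<partial>lborel)"
        by (rule nn_integral_substitution_aux[where f="\<lambda>t. indicator N (\<omega> + \<psi> t)", symmetric])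
           (use pq in \<open>auto simp: J_def \<sigma>_def intro!: deriv_shifted_time continuous_on_deriv_shifted_time
              intro: less_imp_le\<close>)
      also have "\<dots> \<le> (\<integral>\<^sup>+t. indicator N (\<omega> + \<psi> t) * indicator UNIV t \<partial>lborel)"
        by (intro nn_integral_mono) (auto split: split_indicator)
      finally have "(\<integral>\<^sup>+t. indicator N (\<omega> + \<psi> (\<sigma> t)) * ennreal (1 + s' (\<omega> + \<psi> t)) * indicator {p..q} t \<partial>lborel) = 0"
        using N0 by simp
      then have "AE t in lborel. indicator N (\<omega> + \<psi> (\<sigma> t)) * ennreal (1 + s' (\<omega> + \<psi> t)) * indicator {p..q} t = 0"
        by (subst (asm) nn_integral_0_iff_AE) auto
      then show "AE t in lborel. t \<in> {p..q} \<longrightarrow> \<omega> + \<psi> (\<sigma> t) \<notin> N"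
      proof eventually_elim
        fix t
        assume *: "indicator N (\<omega> + \<psi> (\<sigma> t)) * ennreal (1 + s' (\<omega> + \<psi> t)) * indicator {p..q} t = 0"
        show "t \<in> {p..q} \<longrightarrow> \<omega> + \<psi> (\<sigma> t) \<notin> N"
        proof (intro impI notI)
          assume t: "t \<in> {p..q}" "\<omega> + \<psi> (\<sigma> t) \<in> N"
          then have "ennreal (1 + s' (\<omega> + \<psi> t)) = 0" using * by simp
          moreover have "1 + s' (\<omega> + \<psi> t) > 0" using pq t by (auto simp: J_def)
          ultimately show False by simp
        qed
      qed
    qed
    then have "AE t in lborel. indicator C (\<omega> + \<psi> t) * indicator {0..1} t = (0 :: ennreal)"
    proof eventually_elim
      fix t assume t: "\<forall>(p, q)\<in>J. t \<in> {p..q} \<longrightarrow> \<omega> + \<psi> (\<sigma> t) \<notin> N"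
      have "\<omega> + \<psi> t \<notin> C"
      proof
        assume "\<omega> + \<psi> t \<in> C"
        then have pos: "1 + s' (\<omega> + \<psi> t) > 0" and hit: "\<omega> + \<psi> (\<sigma> t) \<in> N"
          by (auto simp: C_def \<sigma>_def psi_add add.assoc)
        have "open {t. 1 + s' (\<omega> + \<psi> t) > 0}"
          by (intro open_Collect_less continuous_on_const continuous_on_deriv_shifted_time)
        then obtain d where d: "d > 0" "\<And>u. \<bar>u - t\<bar> < d \<Longrightarrow> 1 + s' (\<omega> + \<psi> u) > 0"
          using pos unfolding open_dist by (auto simp: dist_real_def)
        obtain p where p: "p \<in> \<rat>" "t - d < p" "p < t"
          using Rats_dense_in_real[of "t - d" t] d by auto
        obtain q where q: "q \<in> \<rat>" "t < q" "q < t + d"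
          using Rats_dense_in_real[of t "t + d"] d by auto
        have "(p, q) \<in> J" using p q d(2) by (auto simp: J_def intro!: d(2))
        with t p q hit show False by force
      qed
      then show "indicator C (\<omega> + \<psi> t) * indicator {0..1} t = (0 :: ennreal)" by simp
    qed
    then show "(\<integral>\<^sup>+t. indicator C (\<omega> + \<psi> t) * indicator {0..1} t \<partial>lborel) = 0"
      by (subst nn_integral_0_iff_AE) auto
  qed
  then have "(\<integral>\<^sup>+\<omega>. (\<integral>\<^sup>+t. indicator C (\<omega> + \<psi> t) * indicator {0..1} t \<partial>lborel) \<partial>\<mu>) = 0"
    by (subst nn_integral_0_iff_AE) auto
  \<comment> \<open>The window \<open>{0..1}\<close> has length 1, so the average is the measure of
    \<open>C\<close> itself.\<close>
  then have "emeasure \<mu> C = 0"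
    by (subst (asm) nn_integral_flow_average) auto
  then have "C \<in> null_sets \<mu>" by (auto simp: sets_mu)
  then show ?thesis by (rule AE_I') (auto simp: C_def)
qed

end

end

section \<open>The ping-pong map on phase space\<close>

locale ping_pong = compact_flow \<psi> \<mu>
  for \<psi> :: "real \<Rightarrow> 'a::{topological_ab_group_add, metric_space}" and \<mu> +
  fixes P :: "'a \<Rightarrow> real" and a b :: real
  assumes a_pos: "0 < a"
    and P_C2: "C2_psi \<psi> P"
    and P_bounds: "a \<le> P \<omega> \<and> P \<omega> \<le> b"
begin

abbreviation P' :: "'a \<Rightarrow> real" where "P' \<equiv> dpsi \<psi> P"
abbreviation P'' :: "'a \<Rightarrow> real" where "P'' \<equiv> dpsi \<psi> P'"
abbreviation forcing :: "'a \<Rightarrow> real \<Rightarrow> real" where "forcing \<omega> \<equiv> \<lambda>t. P (\<omega> + \<psi> t)"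

definition v_star :: real where "v_star = 2 * max (Sup (range P')) 0"
text \<open>\<open>v_star\<close> limits \<open>P'\<close> only from above, which suffices for the
  flight towards the moving wall; the return flight is sensitive to negative \<open>P'\<close> and
  calls for a two-sided bound.\<close>

definition speed_bound :: real where "speed_bound = (SUP \<omega>. \<bar>P' \<omega>\<bar>)"

lemma P_cont: "continuous_on UNIV P" and P'_cont: "continuous_on UNIV P'"
  and P''_cont: "continuous_on UNIV P''"
  using P_C2 by (auto simp: C2_psi_def)

lemma P_meas [measurable]: "P \<in> borel_measurable borel"
  and P'_meas [measurable]: "P' \<in> borel_measurable borel"
  using P_cont P'_cont by (auto intro: borel_measurable_continuous_onI)

lemma P_pos: "0 < P \<omega>" and P_le: "P \<omega> \<le> b" and P_ge: "a \<le> P \<omega>"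
  using P_bounds[of \<omega>] a_pos by auto

lemma b_pos: "0 < b"
  using P_pos P_le by (rule less_le_trans)

lemma has_dpsi_P: "has_dpsi \<psi> P (P' \<omega>) \<omega>" and has_dpsi_P': "has_dpsi \<psi> P' (P'' \<omega>) \<omega>"
  using P_C2 by (auto simp: C2_psi_def intro: has_dpsi_dpsi)

lemma has_dpsi_scaled_P: "has_dpsi \<psi> (\<lambda>\<omega>. k * P \<omega>) (k * P' \<omega>) \<omega>"
proof -
  have "((\<lambda>t. k * ((P (\<omega> + \<psi> t) - P \<omega>) / t)) \<longlongrightarrow> k * P' \<omega>) (at 0)"
    using has_dpsi_P by (intro tendsto_intros) (simp add: has_dpsi_def)
  then show ?thesis by (simp add: has_dpsi_def algebra_simps diff_divide_distrib)
qed

lemma forcing_deriv: "(forcing \<omega> has_real_derivative P' (\<omega> + \<psi> t)) (at t)"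
  and forcing_deriv2: "((\<lambda>t. P' (\<omega> + \<psi> t)) has_real_derivative P'' (\<omega> + \<psi> t)) (at t)"
  by (rule has_dpsi_imp_deriv has_dpsi_P has_dpsi_P')+

lemma bounded_range: "continuous_on UNIV f \<Longrightarrow> bounded (range (f :: 'a \<Rightarrow> real))"
  using compact_continuous_image[OF _ compact_Omega] by (rule compact_imp_bounded)

lemma abs_P'_le: "\<bar>P' \<omega>\<bar> \<le> speed_bound"
proof -
  have "bdd_above (range (\<lambda>\<omega>. \<bar>P' \<omega>\<bar>))"
    using P'_cont by (intro bounded_imp_bdd_above bounded_range continuous_intros)
  then show ?thesis unfolding speed_bound_def by (intro cSUP_upper) auto
qed

lemma P'_bounds: "- speed_bound \<le> P' \<omega>" "P' \<omega> \<le> speed_bound"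
  using abs_P'_le[of \<omega>] by auto

lemma v_star_nonneg: "0 \<le> v_star"
  by (simp add: v_star_def)

lemma two_P'_le: "2 * P' \<omega> \<le> v_star"
proof -
  have "P' \<omega> \<le> Sup (range P')"
    using bounded_imp_bdd_above[OF bounded_range[OF P'_cont]] by (intro cSup_upper) auto
  then show ?thesis by (simp add: v_star_def)
qed

lemma v_star_le: "v_star \<le> 2 * speed_bound"
proof -
  have "Sup (range P') \<le> speed_bound" using P'_bounds by (intro cSup_least) auto
  moreover have "0 \<le> speed_bound" using abs_P'_le by (meson abs_ge_zero order_trans)
  ultimately show ?thesis by (simp add: v_star_def)
qed

lemma P'_less: "v_star < v \<Longrightarrow> P' \<omega> < v"
  using two_P'_le[of \<omega>] v_star_nonneg by linarith

text \<open>The derivative v - P' is positive: the particle is faster than the wall. Uniqueness of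
  the impact time and its comparison with a given time both come from this.\<close>

lemma wall_gap_strict_mono:
  assumes "v_star < v" "s < t"
  shows "s * v - P (\<omega> + \<psi> s) < t * v - P (\<omega> + \<psi> t)"
proof (rule DERIV_pos_imp_increasing[OF \<open>s < t\<close>])
  fix x
  have "((\<lambda>x. x * v - P (\<omega> + \<psi> x)) has_real_derivative v - P' (\<omega> + \<psi> x)) (at x)"
    by (auto intro!: derivative_eq_intros forcing_deriv)
  then show "\<exists>y. ((\<lambda>x. x * v - P (\<omega> + \<psi> x)) has_real_derivative y) (at x) \<and> 0 < y"
    using P'_less[OF assms(1)] by (intro exI[of _ "v - P' (\<omega> + \<psi> x)"]) auto
qed

lemma wall_gap_less_iff:
  assumes "v_star < v"
  shows "s * v - P (\<omega> + \<psi> s) < t * v - P (\<omega> + \<psi> t) \<longleftrightarrow> s < t"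
  using wall_gap_strict_mono[OF assms] by (metis less_asym less_irrefl linorder_less_linear)

lemma pp_tilde_eqI:
  assumes "v_star < v" "(s - t) * v = P (\<omega> + \<psi> s)"
  shows "pp_tilde (forcing \<omega>) t v = s"
  unfolding pp_tilde_def
proof (rule the_equality, rule assms(2))
  fix u assume "(u - t) * v = P (\<omega> + \<psi> u)"
  with assms(2) have "u * v - P (\<omega> + \<psi> u) = s * v - P (\<omega> + \<psi> s)" by (simp add: algebra_simps)
  then show "u = s"
    using wall_gap_strict_mono[OF assms(1), of u s \<omega>] wall_gap_strict_mono[OF assms(1), of s u \<omega>]
    by (cases u s rule: linorder_cases) auto
qed

lemma pp_tilde_eq:
  assumes "v_star < v"
  shows "(pp_tilde (forcing \<omega>) t v - t) * v = P (\<omega> + \<psi> (pp_tilde (forcing \<omega>) t v))"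
proof -
  have v: "0 < v" using assms v_star_nonneg by simp
  \<comment> \<open>After time b / v the particle has covered the distance b, which the wall never
    exceeds.\<close>
  have "\<exists>s\<ge>t. s \<le> t + b / v \<and> (s - t) * v - P (\<omega> + \<psi> s) = 0"
  proof (rule IVT')
    show "(t - t) * v - P (\<omega> + \<psi> t) \<le> 0" using P_pos[of "\<omega> + \<psi> t"] by simp
    show "0 \<le> (t + b / v - t) * v - P (\<omega> + \<psi> (t + b / v))" using P_le v by simp
    show "t \<le> t + b / v" using v b_pos by simp
    show "continuous_on {t..t + b / v} (\<lambda>s. (s - t) * v - P (\<omega> + \<psi> s))"
      by (intro continuous_intros continuous_on_compose2[OF P_cont]) auto
  qed
  then obtain s where "(s - t) * v = P (\<omega> + \<psi> s)" by auto
  with pp_tilde_eqI[OF assms this] show ?thesis by simp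
qed

abbreviation wall_time :: "'a \<Rightarrow> real \<Rightarrow> real" where "wall_time \<omega> v \<equiv> pp_tilde (forcing \<omega>) 0 v"

lemma wall_time_eq: "v_star < v \<Longrightarrow> wall_time \<omega> v * v = P (\<omega> + \<psi> (wall_time \<omega> v))"
  using pp_tilde_eq[of v \<omega> 0] by simp

text \<open>Starting at time t under the forcing of \<omega> is the same as starting at time 0 under
  the forcing of \<omega> + \<psi> t. This is what lets one map serve all forcings.\<close>

lemma pp_tilde_shift:
  assumes "v_star < v"
  shows "pp_tilde (forcing \<omega>) t v = t + wall_time (\<omega> + \<psi> t) v"
  using wall_time_eq[OF assms, of "\<omega> + \<psi> t"]
  by (intro pp_tilde_eqI assms) (simp add: psi_add add.assoc)

lemma wall_time_backward:
  assumes "v_star < v"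
  shows "wall_time (\<omega> + \<psi> (- (P \<omega> / v))) v = P \<omega> / v"
proof (rule pp_tilde_eqI[OF assms])
  have "\<omega> + \<psi> (- (P \<omega> / v)) + \<psi> (P \<omega> / v) = \<omega>" by (simp add: psi_minus)
  then show "(P \<omega> / v - 0) * v = P (\<omega> + \<psi> (- (P \<omega> / v)) + \<psi> (P \<omega> / v))"
    using assms v_star_nonneg by (metis diff_zero less_irrefl nonzero_eq_divide_eq order.strict_trans1)
qed

text \<open>The impact time is given by a definite description; this expresses its sublevel sets by
  an inequality in \<open>P\<close>, from which measurability follows.\<close>

lemma wall_time_le_iff:
  assumes "v_star < v"
  shows "wall_time \<omega> v \<le> c \<longleftrightarrow> P (\<omega> + \<psi> c) \<le> c * v"
  using wall_gap_less_iff[OF assms, of c \<omega> "wall_time \<omega> v"] wall_time_eq[OF assms, of \<omega>] by auto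

text \<open>Stopping at speeds up to \<open>v_star\<close> makes the map total and measurable
  without creating escaping orbits: a stopped point violates the speed condition forever.\<close>

definition pp_step :: "'a \<times> real \<Rightarrow> 'a \<times> real" where
  "pp_step = (\<lambda>(\<omega>, v). if v_star < v then
     let \<omega>' = \<omega> + \<psi> (wall_time \<omega> v); v' = v - 2 * P' \<omega>' in (\<omega>' + \<psi> (P \<omega>' / v'), v')
   else (\<omega>, v))"

abbreviation phase_space :: "('a \<times> real) measure" where "phase_space \<equiv> \<mu> \<Otimes>\<^sub>M lborel"

lemma space_phase_space [simp]: "space phase_space = UNIV"
  by (simp add: space_pair_measure)

lemma wall_time_meas [measurable]:
  "(\<lambda>x. if v_star < snd x then wall_time (fst x) (snd x) else 0) \<in> borel_measurable phase_space"
  (is "?f \<in> _")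
proof (subst borel_measurable_iff_le, intro allI)
  fix c
  have "{x \<in> space phase_space. ?f x \<le> c} = {x \<in> space phase_space.
      (v_star < snd x \<and> P (fst x + \<psi> c) \<le> c * snd x) \<or> (\<not> v_star < snd x \<and> 0 \<le> c)}"
    using wall_time_le_iff by auto
  also have "\<dots> \<in> sets phase_space" by measurable
  finally show "{x \<in> space phase_space. ?f x \<le> c} \<in> sets phase_space" .
qed

lemma pp_step_meas [measurable]: "pp_step \<in> phase_space \<rightarrow>\<^sub>M phase_space"
proof -
  define w where "w x = fst x + \<psi> (if v_star < snd x then wall_time (fst x) (snd x) else 0)" for x
  have [measurable]: "w \<in> phase_space \<rightarrow>\<^sub>M borel" unfolding w_def by measurable
  have "(\<lambda>x. if v_star < snd x then (w x + \<psi> (P (w x) / (snd x - 2 * P' (w x))), snd x - 2 * P' (w x)) else x)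
      \<in> phase_space \<rightarrow>\<^sub>M phase_space"
    by measurable
  also have "(\<lambda>x. if v_star < snd x then (w x + \<psi> (P (w x) / (snd x - 2 * P' (w x))), snd x - 2 * P' (w x)) else x)
      = pp_step"
    by (auto simp: pp_step_def w_def Let_def fun_eq_iff)
  finally show ?thesis .
qed

section \<open>Correspondence with the ping-pong map of a single forcing\<close>

lemma pp_step_pp_map:
  assumes "v_star < snd y"
  shows "pp_step (\<omega> + \<psi> (fst y), snd y)
    = (\<omega> + \<psi> (fst (pp_map (forcing \<omega>) y)), snd (pp_map (forcing \<omega>) y))"
proof -
  have "deriv (forcing \<omega>) u = P' (\<omega> + \<psi> u)" for u
    by (rule DERIV_imp_deriv[OF forcing_deriv])
  then show ?thesis
    using assms by (simp add: pp_step_def pp_map_def Let_def pp_tilde_shift psi_add add.assoc)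
qed

text \<open>The threshold is a parameter because two values occur: \<open>v_star\<close> for the
  final claim and \<open>2 * speed_bound\<close> for the measure estimates.\<close>

definition escape :: "real \<Rightarrow> ('a \<times> real) set" where
  "escape c = {x. (\<forall>n. c < snd ((pp_step ^^ n) x)) \<and>
     filterlim (\<lambda>n. snd ((pp_step ^^ n) x)) at_top sequentially}"

text \<open>The semiconjugacy holds only while the speed exceeds \<open>v_star\<close>. Each
  inclusion therefore has its own induction, fed by the speed bound on the orbit that is assumed to
  escape.\<close>

lemma escaping_set_eq:
  "escaping_set (forcing \<omega>) v_star = {y. (\<omega> + \<psi> (fst y), snd y) \<in> escape v_star}"
proof -
  let ?\<Pi> = "\<lambda>y. (\<omega> + \<psi> (fst y), snd y)"
  have step: "(pp_step ^^ Suc n) (?\<Pi> y) = ?\<Pi> (pp_orbit (forcing \<omega>) y (Suc n))"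
    if "(pp_step ^^ n) (?\<Pi> y) = ?\<Pi> (pp_orbit (forcing \<omega>) y n)"
      "v_star < snd (pp_orbit (forcing \<omega>) y n)" for y n
    using that by (simp add: pp_step_pp_map pp_orbit_def)
  have pp_orbit: "(pp_step ^^ n) (?\<Pi> y) = ?\<Pi> (pp_orbit (forcing \<omega>) y n)"
    if "\<And>n. v_star < snd (pp_orbit (forcing \<omega>) y n)" for y n
  proof (induction n)
    case 0 show ?case by (simp add: pp_orbit_def)
  qed (use that step in blast)
  have pp_step: "(pp_step ^^ n) (?\<Pi> y) = ?\<Pi> (pp_orbit (forcing \<omega>) y n)"
    if "\<And>n. v_star < snd ((pp_step ^^ n) (?\<Pi> y))" for y n
  proof (induction n)
    case 0 show ?case by (simp add: pp_orbit_def)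
  next
    case (Suc n)
    with that[of n] show ?case by (intro step) auto
  qed
  have "y \<in> escaping_set (forcing \<omega>) v_star \<longleftrightarrow> ?\<Pi> y \<in> escape v_star" for y
  proof
    assume y: "y \<in> escaping_set (forcing \<omega>) v_star"
    then have "(pp_step ^^ n) (?\<Pi> y) = ?\<Pi> (pp_orbit (forcing \<omega>) y n)" for n
      by (intro pp_orbit) (simp add: escaping_set_def)
    with y show "?\<Pi> y \<in> escape v_star" by (simp add: escape_def escaping_set_def)
  next
    assume y: "?\<Pi> y \<in> escape v_star"
    then have "(pp_step ^^ n) (?\<Pi> y) = ?\<Pi> (pp_orbit (forcing \<omega>) y n)" for n
      by (intro pp_step) (simp add: escape_def)
    moreover have "v_star < snd ((pp_step ^^ 0) (?\<Pi> y))" using y unfolding escape_def by blast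
    ultimately show "y \<in> escaping_set (forcing \<omega>) v_star"
      using y by (simp add: escape_def escaping_set_def)
  qed
  then show ?thesis by blast
qed

text \<open>Both flights have an explicit inverse in terms of the phase \<open>\<omega>'\<close> at the moving
  wall: a start with speed \<open>v\<close> is \<open>\<omega>' - \<psi> (P \<omega>' / v)\<close>, a return with speed \<open>v'\<close> is
  \<open>\<omega>' + \<psi> (P \<omega>' / v')\<close>. The two Jacobians match because \<open>v - P' \<omega>' = v' + P' \<omega>'\<close>.\<close>
lemma nn_integral_pp_step:
  assumes g[measurable]: "g \<in> borel_measurable phase_space"
  shows "(\<integral>\<^sup>+x. (if v_star < snd x \<and> v_star < snd (pp_step x) then ennreal (snd x) * g (pp_step x) else 0) \<partial>phase_space)
    = (\<integral>\<^sup>+v. (\<integral>\<^sup>+\<omega>. (if v_star < v \<and> v_star < v + 2 * P' \<omega>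
        then ennreal (v + P' \<omega>) * g (\<omega> + \<psi> (P \<omega> / v), v) else 0) \<partial>\<mu>) \<partial>lborel)"
    (is "?L = ?R")
proof -
  \<comment> \<open>\<open>g\<close> after the impact and the return flight, as a function of the
    incoming speed and of the phase at the moving wall.\<close>
  define h where "h v \<omega> = (if v_star < v - 2 * P' \<omega>
      then g (\<omega> + \<psi> (P \<omega> / (v - 2 * P' \<omega>)), v - 2 * P' \<omega>) else 0)" for v \<omega>
  have h_meas[measurable]: "(\<lambda>x. h (fst x) (snd x)) \<in> borel_measurable (borel \<Otimes>\<^sub>M borel)"
    unfolding h_def by measurable
  have [measurable]: "(\<lambda>x. h (snd x) (fst x)) \<in> borel_measurable (borel \<Otimes>\<^sub>M borel)"
    unfolding h_def by measurable
  have h_meas'[measurable]: "h v \<in> borel_measurable borel" for v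
    using measurable_compose[OF _ h_meas, of "\<lambda>\<omega>. (v, \<omega>)" borel] by simp
  have "?L = (\<integral>\<^sup>+v. (\<integral>\<^sup>+\<omega>. (if v_star < v \<and> v_star < snd (pp_step (\<omega>, v))
      then ennreal v * g (pp_step (\<omega>, v)) else 0) \<partial>\<mu>) \<partial>lborel)"
    by (subst mu_lborel.nn_integral_snd[symmetric]) (simp_all cong: if_cong)
  also have "\<dots> = (\<integral>\<^sup>+v. (\<integral>\<^sup>+\<omega>. (if v_star < v then h v \<omega> * ennreal (v - P' \<omega>) else 0) \<partial>\<mu>) \<partial>lborel)"
  proof (rule nn_integral_cong)
    fix v :: real
    show "(\<integral>\<^sup>+\<omega>. (if v_star < v \<and> v_star < snd (pp_step (\<omega>, v)) then ennreal v * g (pp_step (\<omega>, v)) else 0) \<partial>\<mu>)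
      = (\<integral>\<^sup>+\<omega>. (if v_star < v then h v \<omega> * ennreal (v - P' \<omega>) else 0) \<partial>\<mu>)"
    proof (cases "v_star < v")
      case True
      then have v: "0 < v" using v_star_nonneg by simp
      have "(\<lambda>\<omega>. if v_star < snd (\<omega>, v) then wall_time (fst (\<omega>, v)) (snd (\<omega>, v)) else 0)
          \<in> borel_measurable \<mu>"
        by (rule measurable_compose[OF _ wall_time_meas]) measurable
      then have [measurable]: "(\<lambda>\<omega>. wall_time \<omega> v) \<in> borel_measurable borel" using True by simp
      have "(\<integral>\<^sup>+\<omega>. (if v_star < v \<and> v_star < snd (pp_step (\<omega>, v)) then ennreal v * g (pp_step (\<omega>, v)) else 0) \<partial>\<mu>)
          = (\<integral>\<^sup>+\<omega>. ennreal v * h v (\<omega> + \<psi> (wall_time \<omega> v)) \<partial>\<mu>)"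
        using True by (intro nn_integral_cong) (simp add: pp_step_def h_def Let_def)
      also have "\<dots> = ennreal v * (\<integral>\<^sup>+\<omega>. h v (\<omega> + \<psi> (wall_time \<omega> v)) \<partial>\<mu>)"
        by (rule nn_integral_cmult) measurable
      \<comment> \<open>Substituting the explicit start phase, that is s = - P / v, cancels the
        implicit \<open>wall_time\<close>; the Jacobian 1 - P' / v times v leaves v - P'.\<close>
      also have "(\<integral>\<^sup>+\<omega>. h v (\<omega> + \<psi> (wall_time \<omega> v)) \<partial>\<mu>)
        = (\<integral>\<^sup>+\<omega>. (\<lambda>\<omega>. h v (\<omega> + \<psi> (wall_time \<omega> v))) (\<omega> + \<psi> ((- 1 / v) * P \<omega>)) * ennreal (1 + (- 1 / v) * P' \<omega>) \<partial>\<mu>)"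
      proof (rule nn_integral_flow_shift[symmetric, OF has_dpsi_scaled_P
            continuous_on_mult_left[OF P_cont] continuous_on_mult_left[OF P'_cont]])
        show "0 \<le> 1 + (- 1 / v) * P' \<omega>" for \<omega>
          using P'_less[OF True, of \<omega>] v by (simp add: field_simps)
      qed measurable
      also have "ennreal v * \<dots> = (\<integral>\<^sup>+\<omega>. h v \<omega> * ennreal (v - P' \<omega>) \<partial>\<mu>)"
      proof -
        have "ennreal v * (h v (\<omega> + \<psi> ((- 1 / v) * P \<omega>) + \<psi> (wall_time (\<omega> + \<psi> ((- 1 / v) * P \<omega>)) v))
            * ennreal (1 + (- 1 / v) * P' \<omega>)) = h v \<omega> * ennreal (v - P' \<omega>)" for \<omega>
        proof -
          have "ennreal v * ennreal (1 + (- 1 / v) * P' \<omega>) = ennreal (v - P' \<omega>)"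
            using v by (simp add: ennreal_mult'[symmetric] right_diff_distrib)
          moreover have "(- 1 / v) * P \<omega> = - (P \<omega> / v)" by simp
          ultimately show ?thesis
            using wall_time_backward[OF True, of \<omega>]
            by (simp add: psi_minus mult.left_commute[of "ennreal v"])
        qed
        then show ?thesis by (subst nn_integral_cmult[symmetric]) simp_all
      qed
      finally show ?thesis using True by simp
    qed simp
  qed
  also have "\<dots> = (\<integral>\<^sup>+\<omega>. (\<integral>\<^sup>+v. (if v_star < v then h v \<omega> * ennreal (v - P' \<omega>) else 0) \<partial>lborel) \<partial>\<mu>)"
    by (rule mu_lborel.Fubini') measurable
  also have "\<dots> = (\<integral>\<^sup>+\<omega>. (\<integral>\<^sup>+v. (if v_star < v \<and> v_star < v + 2 * P' \<omega>
        then ennreal (v + P' \<omega>) * g (\<omega> + \<psi> (P \<omega> / v), v) else 0) \<partial>lborel) \<partial>\<mu>)"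
  proof (rule nn_integral_cong)
    fix \<omega>
    have [measurable]: "(\<lambda>v. h v \<omega>) \<in> borel_measurable borel"
      using measurable_compose[OF _ h_meas, of "\<lambda>v. (v, \<omega>)" borel] by simp
    \<comment> \<open>At a fixed impact phase the impact translates the speed by - 2 * P'; the new
      variable is the speed after it.\<close>
    have "(\<integral>\<^sup>+v. (if v_star < v then h v \<omega> * ennreal (v - P' \<omega>) else 0) \<partial>lborel)
      = ennreal \<bar>1\<bar> * (\<integral>\<^sup>+v. (if v_star < 2 * P' \<omega> + 1 * v then h (2 * P' \<omega> + 1 * v) \<omega> * ennreal (2 * P' \<omega> + 1 * v - P' \<omega>) else 0) \<partial>lborel)"
      by (rule nn_integral_real_affine) simp_all
    also have "\<dots> = (\<integral>\<^sup>+v. (if v_star < v \<and> v_star < v + 2 * P' \<omega>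
        then ennreal (v + P' \<omega>) * g (\<omega> + \<psi> (P \<omega> / v), v) else 0) \<partial>lborel)"
      by (simp, intro nn_integral_cong) (auto simp: h_def algebra_simps)
    finally show "(\<integral>\<^sup>+v. (if v_star < v then h v \<omega> * ennreal (v - P' \<omega>) else 0) \<partial>lborel) =
      (\<integral>\<^sup>+v. (if v_star < v \<and> v_star < v + 2 * P' \<omega>
        then ennreal (v + P' \<omega>) * g (\<omega> + \<psi> (P \<omega> / v), v) else 0) \<partial>lborel)" .
  qed
  also have "\<dots> = ?R"
    by (rule mu_lborel.Fubini'[symmetric]) measurable
  finally show ?thesis .
qed

text \<open>Valid down to \<open>v_star\<close>, where folding could spoil a measure inequality: at
  each fixed outgoing speed \<open>AE_flow_shift\<close> handles the return flight, and the weight v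
  is positive.\<close>

lemma null_sets_pp_step_vimage:
  assumes N: "N \<in> null_sets phase_space"
  shows "{x. v_star < snd x \<and> v_star < snd (pp_step x) \<and> pp_step x \<in> N} \<in> null_sets phase_space"
proof -
  have [measurable]: "N \<in> sets phase_space" using N by auto
  have "AE x in phase_space. x \<notin> N" using N by (rule AE_not_in)
  then have "AE \<omega> in \<mu>. AE v in lborel. (\<omega>, v) \<notin> N" by (rule mu_lborel.AE_pair)
  then have "AE v in lborel. AE \<omega> in \<mu>. (\<omega>, v) \<notin> N"
    by (subst (asm) mu_lborel.AE_commute) (simp_all only: prod.collapse, measurable)
  then have "AE v in lborel. (\<integral>\<^sup>+\<omega>. (if v_star < v \<and> v_star < v + 2 * P' \<omega>
        then ennreal (v + P' \<omega>) * indicator N (\<omega> + \<psi> (P \<omega> / v), v) else 0) \<partial>\<mu>) = 0"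
  proof eventually_elim
    fix v :: real assume ae: "AE \<omega> in \<mu>. (\<omega>, v) \<notin> N"
    define Nv where "Nv = {\<omega>. (\<omega>, v) \<in> N}"
    have [measurable]: "Nv \<in> sets borel"
    proof -
      have "Measurable.pred \<mu> (\<lambda>\<omega>. (\<omega>, v) \<in> N)" by measurable
      then show ?thesis by (simp add: pred_def Nv_def sets_mu)
    qed
    have "Nv \<in> null_sets \<mu>" using ae by (subst AE_iff_null_sets) (auto simp: Nv_def sets_mu)
    then have "AE \<omega> in \<mu>. 1 + (1 / v) * P' \<omega> > 0 \<longrightarrow> \<omega> + \<psi> ((1 / v) * P \<omega>) \<notin> Nv"
      by (intro AE_flow_shift has_dpsi_scaled_P continuous_intros P_cont P'_cont)
    then have "AE \<omega> in \<mu>. (if v_star < v \<and> v_star < v + 2 * P' \<omega>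
        then ennreal (v + P' \<omega>) * indicator N (\<omega> + \<psi> (P \<omega> / v), v) else 0) = 0"
    proof eventually_elim
      fix \<omega> assume *: "1 + (1 / v) * P' \<omega> > 0 \<longrightarrow> \<omega> + \<psi> ((1 / v) * P \<omega>) \<notin> Nv"
      show "(if v_star < v \<and> v_star < v + 2 * P' \<omega>
        then ennreal (v + P' \<omega>) * indicator N (\<omega> + \<psi> (P \<omega> / v), v) else 0) = 0"
      proof (cases "v_star < v \<and> v_star < v + 2 * P' \<omega>")
        case True
        \<comment> \<open>v + P' is the mean of v and v + 2 * P', both above
          \<open>v_star\<close>.\<close>
        then have "0 < v" "0 < v + P' \<omega>" using v_star_nonneg by auto
        then have "1 + (1 / v) * P' \<omega> > 0" by (simp add: field_simps)
        with * show ?thesis by (simp add: Nv_def)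
      qed auto
    qed
    then show "(\<integral>\<^sup>+\<omega>. (if v_star < v \<and> v_star < v + 2 * P' \<omega>
        then ennreal (v + P' \<omega>) * indicator N (\<omega> + \<psi> (P \<omega> / v), v) else 0) \<partial>\<mu>) = 0"
      by (simp cong: nn_integral_cong_AE)
  qed
  from nn_integral_cong_AE[OF this]
  have "(\<integral>\<^sup>+x. (if v_star < snd x \<and> v_star < snd (pp_step x)
      then ennreal (snd x) * indicator N (pp_step x) else 0) \<partial>phase_space) = 0"
    by (subst nn_integral_pp_step) simp_all
  moreover have "(\<lambda>x. if v_star < snd x \<and> v_star < snd (pp_step x)
      then ennreal (snd x) * indicator N (pp_step x) else 0) \<in> borel_measurable phase_space"
    by measurable
  ultimately have "AE x in phase_space. (if v_star < snd x \<and> v_star < snd (pp_step x)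
      then ennreal (snd x) * indicator N (pp_step x) else 0) = 0"
    by (simp only: nn_integral_0_iff_AE)
  then have "AE x in phase_space. \<not> (v_star < snd x \<and> v_star < snd (pp_step x) \<and> pp_step x \<in> N)"
  proof eventually_elim
    fix x :: "'a \<times> real"
    assume "(if v_star < snd x \<and> v_star < snd (pp_step x) then ennreal (snd x) * indicator N (pp_step x) else 0) = 0"
    then show "\<not> (v_star < snd x \<and> v_star < snd (pp_step x) \<and> pp_step x \<in> N)"
      using v_star_nonneg by (cases "pp_step x \<in> N") (auto simp: ennreal_eq_0_iff)
  qed
  moreover have "{x \<in> space phase_space. v_star < snd x \<and> v_star < snd (pp_step x) \<and> pp_step x \<in> N} \<in> sets phase_space"
    by measurable
  ultimately show ?thesis by (subst AE_iff_null_sets) simp_all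
qed

text \<open>With the energy E = v^2 / 2 this is the product of \<open>\<mu>\<close> with dE. For
  negative speeds \<open>ennreal\<close> cuts the density to 0, hence the positivity condition when
  null sets are compared with \<open>phase_space\<close>.\<close>

definition liouville :: "('a \<times> real) measure" where
  "liouville = density phase_space (\<lambda>x. ennreal (snd x))"

lemma sets_liouville [measurable_cong, simp]: "sets liouville = sets phase_space"
  by (simp add: liouville_def)

lemma emeasure_liouville:
  "B \<in> sets phase_space \<Longrightarrow> emeasure liouville B = (\<integral>\<^sup>+x. ennreal (snd x) * indicator B x \<partial>phase_space)"
  unfolding liouville_def by (rule emeasure_density[rotated]) (assumption, measurable)

lemma null_sets_liouville_iff:
  assumes [measurable]: "B \<in> sets phase_space" and pos: "\<And>x. x \<in> B \<Longrightarrow> 0 < snd x"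
  shows "B \<in> null_sets liouville \<longleftrightarrow> B \<in> null_sets phase_space"
proof -
  have eq: "(x \<in> B \<longrightarrow> ennreal (snd x) = 0) \<longleftrightarrow> x \<notin> B" for x
    using pos[of x] by (auto simp: ennreal_eq_0_iff)
  show ?thesis
    unfolding liouville_def using assms(1)
    by (subst null_sets_density_iff) (simp_all only: eq AE_iff_null_sets, measurable)
qed

text \<open>Above this speed bound the return flight is a monotone time change for every phase,
  which makes the map injective; for smaller \<open>v\<close> it need not be.\<close>
lemma emeasure_pp_step_vimage_le:
  assumes B[measurable]: "B \<in> sets phase_space" and fast: "\<And>x. x \<in> B \<Longrightarrow> 2 * speed_bound < snd x"
    and A[measurable]: "A \<in> sets phase_space" and A_dom: "\<And>x. x \<in> A \<Longrightarrow> v_star < snd x"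
  shows "emeasure liouville (A \<inter> pp_step -` B) \<le> emeasure liouville B"
proof -
  have vim: "A \<inter> pp_step -` B \<in> sets phase_space"
  proof -
    have "pp_step -` B \<inter> space phase_space \<in> sets phase_space" by measurable
    then show ?thesis using A by (metis Int_UNIV_right sets.Int space_phase_space)
  qed
  have "emeasure liouville (A \<inter> pp_step -` B) \<le> (\<integral>\<^sup>+x. (if v_star < snd x \<and> v_star < snd (pp_step x)
      then ennreal (snd x) * indicator B (pp_step x) else 0) \<partial>phase_space)"
    unfolding emeasure_liouville[OF vim]
  proof (rule nn_integral_mono)
    fix x
    show "ennreal (snd x) * indicator (A \<inter> pp_step -` B) x
        \<le> (if v_star < snd x \<and> v_star < snd (pp_step x) then ennreal (snd x) * indicator B (pp_step x) else 0)"
      using A_dom[of x] fast[of "pp_step x"] v_star_le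
      by (cases "x \<in> A \<and> pp_step x \<in> B") auto
  qed
  also have "\<dots> = (\<integral>\<^sup>+v. (\<integral>\<^sup>+\<omega>. (if v_star < v \<and> v_star < v + 2 * P' \<omega>
        then ennreal (v + P' \<omega>) * indicator B (\<omega> + \<psi> (P \<omega> / v), v) else 0) \<partial>\<mu>) \<partial>lborel)"
    by (rule nn_integral_pp_step) measurable
  also have "\<dots> \<le> (\<integral>\<^sup>+v. (\<integral>\<^sup>+\<omega>. ennreal v * indicator B (\<omega>, v) \<partial>\<mu>) \<partial>lborel)"
  proof (rule nn_integral_mono)
    fix v :: real
    show "(\<integral>\<^sup>+\<omega>. (if v_star < v \<and> v_star < v + 2 * P' \<omega>
        then ennreal (v + P' \<omega>) * indicator B (\<omega> + \<psi> (P \<omega> / v), v) else 0) \<partial>\<mu>)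
      \<le> (\<integral>\<^sup>+\<omega>. ennreal v * indicator B (\<omega>, v) \<partial>\<mu>)"
    proof (cases "2 * speed_bound < v")
      case True
      then have v: "0 < v" using v_star_nonneg v_star_le by simp
      have slow: "0 < v + P' \<omega>" for \<omega>
        using True P'_bounds[of \<omega>] v by linarith
      have Bv: "(\<lambda>\<omega>. indicator B (\<omega>, v) :: ennreal) \<in> borel_measurable borel"
        by measurable
      have "(\<integral>\<^sup>+\<omega>. (if v_star < v \<and> v_star < v + 2 * P' \<omega>
          then ennreal (v + P' \<omega>) * indicator B (\<omega> + \<psi> (P \<omega> / v), v) else 0) \<partial>\<mu>)
        \<le> (\<integral>\<^sup>+\<omega>. ennreal v * (indicator B (\<omega> + \<psi> ((1 / v) * P \<omega>), v) * ennreal (1 + (1 / v) * P' \<omega>)) \<partial>\<mu>)"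
      proof (rule nn_integral_mono)
        fix \<omega>
        have "ennreal v * ennreal (1 + (1 / v) * P' \<omega>) = ennreal (v + P' \<omega>)"
          using v by (simp add: ennreal_mult'[symmetric] distrib_left)
        then show "(if v_star < v \<and> v_star < v + 2 * P' \<omega>
            then ennreal (v + P' \<omega>) * indicator B (\<omega> + \<psi> (P \<omega> / v), v) else 0)
          \<le> ennreal v * (indicator B (\<omega> + \<psi> ((1 / v) * P \<omega>), v) * ennreal (1 + (1 / v) * P' \<omega>))"
          by (simp add: indicator_def)
      qed
      also have "\<dots> = ennreal v * (\<integral>\<^sup>+\<omega>. indicator B (\<omega> + \<psi> ((1 / v) * P \<omega>), v) * ennreal (1 + (1 / v) * P' \<omega>) \<partial>\<mu>)"
        by (rule nn_integral_cmult) measurable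
      also have "(\<integral>\<^sup>+\<omega>. indicator B (\<omega> + \<psi> ((1 / v) * P \<omega>), v) * ennreal (1 + (1 / v) * P' \<omega>) \<partial>\<mu>)
          = (\<integral>\<^sup>+\<omega>. indicator B (\<omega>, v) \<partial>\<mu>)"
      proof (rule nn_integral_flow_shift[OF has_dpsi_scaled_P
            continuous_on_mult_left[OF P_cont] continuous_on_mult_left[OF P'_cont] Bv])
        show "0 \<le> 1 + (1 / v) * P' \<omega>" for \<omega> using slow[of \<omega>] v by (simp add: field_simps)
      qed
      also have "ennreal v * \<dots> = (\<integral>\<^sup>+\<omega>. ennreal v * indicator B (\<omega>, v) \<partial>\<mu>)"
        by (rule nn_integral_cmult[symmetric]) measurable
      finally show ?thesis .
    next
      case False
      then have "(\<omega>, v) \<notin> B" for \<omega> using fast[of "(\<omega>, v)"] by auto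
      then show ?thesis by (simp cong: if_cong)
    qed
  qed
  also have "\<dots> = emeasure liouville B"
    by (subst emeasure_liouville[OF B], subst mu_lborel.nn_integral_snd[symmetric]) simp_all
  finally show ?thesis .
qed


section \<open>The adiabatic invariant\<close>

text \<open>The metric is not assumed translation invariant, so uniformity in \<omega> is obtained
  from the compact product of the group with a time interval.\<close>

lemma P''_uniform:
  assumes "0 < \<eta>"
  shows "\<exists>\<delta>>0. \<forall>\<omega> t. \<bar>t\<bar> \<le> \<delta> \<longrightarrow> \<bar>P'' (\<omega> + \<psi> t) - P'' \<omega>\<bar> \<le> \<eta>"
proof -
  have "uniformly_continuous_on (UNIV \<times> {-1..1}) (\<lambda>x. P'' (fst x + \<psi> (snd x)))"
    by (intro compact_uniformly_continuous compact_Times compact_Omega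
          continuous_on_compose2[OF P''_cont] continuous_intros) auto
  then obtain d where d: "0 < d" "\<And>x y. x \<in> UNIV \<times> {-1..1} \<Longrightarrow> y \<in> UNIV \<times> {-1..1} \<Longrightarrow> dist y x < d \<Longrightarrow>
      dist (P'' (fst y + \<psi> (snd y))) (P'' (fst x + \<psi> (snd x))) < \<eta>"
    unfolding uniformly_continuous_on_def using assms by meson
  show ?thesis
  proof (intro exI[of _ "min 1 (d / 2)"] conjI allI impI)
    show "0 < min 1 (d / 2)" using d by simp
    fix \<omega> :: 'a and t :: real assume t: "\<bar>t\<bar> \<le> min 1 (d / 2)"
    then have "dist (\<omega>, t) (\<omega>, 0) < d" using d(1) by (simp add: dist_Pair_Pair)
    from d(2)[OF _ _ this] t d(1) show "\<bar>P'' (\<omega> + \<psi> t) - P'' \<omega>\<bar> \<le> \<eta>"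
      by (auto simp: dist_real_def abs_le_iff)
  qed
qed

text \<open>The Lagrange form keeps the remainder as a value of \<open>P''\<close> at a nearby
  phase, so that two remainders can be compared by \<open>P''_uniform\<close>.\<close>

lemma P_taylor: "\<exists>\<xi>. \<bar>\<xi>\<bar> \<le> \<bar>h\<bar> \<and> P (\<omega> + \<psi> h) = P \<omega> + P' \<omega> * h + P'' (\<omega> + \<psi> \<xi>) * h\<^sup>2 / 2"
proof (cases "h = 0")
  case False
  define D where "D m t = (if m = 0 then P (\<omega> + \<psi> t) else if m = 1 then P' (\<omega> + \<psi> t) else P'' (\<omega> + \<psi> t))"
    for m :: nat and t
  have "\<exists>t. (if h < 0 then h < t \<and> t < 0 else 0 < t \<and> t < h) \<and>
      forcing \<omega> h = (\<Sum>m<2. D m 0 / fact m * (h - 0) ^ m) + D 2 t / fact 2 * (h - 0) ^ 2"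
  proof (rule Taylor[where a="- \<bar>h\<bar>" and b="\<bar>h\<bar>"])
    show "\<forall>m t. m < 2 \<and> - \<bar>h\<bar> \<le> t \<and> t \<le> \<bar>h\<bar> \<longrightarrow> (D m has_real_derivative D (Suc m) t) (at t)"
      using forcing_deriv forcing_deriv2 by (auto simp: D_def[abs_def] less_2_cases_iff)
  qed (use False in \<open>auto simp: D_def\<close>)
  then obtain t where t: "if h < 0 then h < t \<and> t < 0 else 0 < t \<and> t < h"
      "forcing \<omega> h = (\<Sum>m<2. D m 0 / fact m * (h - 0) ^ m) + D 2 t / fact 2 * (h - 0) ^ 2"
    by blast
  have "\<bar>t\<bar> \<le> \<bar>h\<bar>" using t(1) by (auto split: if_splits)
  moreover have "forcing \<omega> h = P \<omega> + P' \<omega> * h + P'' (\<omega> + \<psi> t) * h\<^sup>2 / 2"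
    using t(2) by (simp add: D_def numeral_2_eq_2)
  ultimately show ?thesis by blast
qed simp

text \<open>For a wall frozen at distance P \<omega> this is half the action of one round
  trip.\<close>

definition adiabatic :: "'a \<times> real \<Rightarrow> real" where "adiabatic x = P (fst x) * snd x"

lemma adiabatic_meas [measurable]: "adiabatic \<in> borel_measurable phase_space"
  unfolding adiabatic_def[abs_def] by measurable

text \<open>For a uniformly moving wall \<open>P \<omega> * v\<close> is an exact invariant; expanding around the
  impact at the moving wall, only the difference of two values of \<open>P''\<close> at nearby times remains.\<close>
lemma adiabatic_step_le:
  assumes "0 < \<eta>"
  shows "\<exists>V. \<forall>x. V \<le> snd x \<longrightarrow> adiabatic (pp_step x) \<le> adiabatic x + \<eta> / snd x"
proof -
  obtain K where K: "\<And>\<omega>. \<bar>P'' \<omega>\<bar> \<le> K"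
    using bounded_range[OF P''_cont] by (auto simp: bounded_iff)
  then have K0: "0 \<le> K" by (meson abs_ge_zero order_trans)
  define M where "M = speed_bound"
  have M0: "0 \<le> M" using abs_P'_le unfolding M_def by (meson abs_ge_zero order_trans)
  have "0 < \<eta> / (4 * b\<^sup>2)" using assms b_pos by simp
  from P''_uniform[OF this]
  obtain \<delta> where \<delta>: "0 < \<delta>" "\<And>\<omega> t. \<bar>t\<bar> \<le> \<delta> \<Longrightarrow> \<bar>P'' (\<omega> + \<psi> t) - P'' \<omega>\<bar> \<le> \<eta> / (4 * b\<^sup>2)"
    by blast
  \<comment> \<open>In order, the summands ensure v' > v / 2, make the effect of the changed speed
    at most \<eta> / b^2, keep both flight times below \<delta>, and give v \<ge> 1.\<close>
  define V where "V = 4 * M + 4 * b\<^sup>2 * K * M / \<eta> + 2 * b / \<delta> + 1"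
  have terms: "0 \<le> 4 * b\<^sup>2 * K * M / \<eta>" "0 \<le> 2 * b / \<delta>" using K0 M0 assms b_pos \<delta>(1) by auto
  show ?thesis
  proof (intro exI[of _ V] allI impI)
    fix x :: "'a \<times> real" assume xV: "V \<le> snd x"
    obtain \<omega> v where x: "x = (\<omega>, v)" by (cases x)
    have v: "4 * M < v" "4 * b\<^sup>2 * K * M / \<eta> \<le> v" "2 * b / \<delta> \<le> v" "1 \<le> v"
      using xV terms M0 by (auto simp: V_def x)
    have v_star: "v_star < v" using v(1) v_star_le M0 by (simp add: M_def)
    define \<omega>' where "\<omega>' = \<omega> + \<psi> (wall_time \<omega> v)"
    define p where "p = P \<omega>'"
    define d where "d = P' \<omega>'"
    define v' where "v' = v - 2 * d"
    have d: "\<bar>d\<bar> \<le> M" using abs_P'_le by (simp add: d_def M_def)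
    have v': "v / 2 < v'" "0 < v'" using v(1,4) d by (auto simp: v'_def)
    have p: "0 < p" "p \<le> b" using P_pos P_le by (auto simp: p_def)
    have wt: "wall_time \<omega> v = p / v"
      using wall_time_eq[OF v_star, of \<omega>] v(4) by (simp add: p_def \<omega>'_def field_simps)
    have \<omega>: "\<omega> = \<omega>' + \<psi> (- (p / v))" by (simp add: \<omega>'_def wt psi_minus)
    have step: "pp_step x = (\<omega>' + \<psi> (p / v'), v')"
      using v_star by (simp add: pp_step_def x Let_def \<omega>'_def p_def v'_def d_def)
    obtain \<xi>0 where \<xi>0: "\<bar>\<xi>0\<bar> \<le> \<bar>- (p / v)\<bar>"
        "P \<omega> = p + d * (- (p / v)) + P'' (\<omega>' + \<psi> \<xi>0) * (- (p / v))\<^sup>2 / 2"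
      using P_taylor[of "- (p / v)" \<omega>', folded \<omega> p_def d_def] by (elim exE conjE)
    obtain \<xi>1 where \<xi>1: "\<bar>\<xi>1\<bar> \<le> \<bar>p / v'\<bar>"
        "P (\<omega>' + \<psi> (p / v')) = p + d * (p / v') + P'' (\<omega>' + \<psi> \<xi>1) * (p / v')\<^sup>2 / 2"
      using P_taylor[of "p / v'" \<omega>', folded p_def d_def] by (elim exE conjE)
    define q0 where "q0 = P'' (\<omega>' + \<psi> \<xi>0)"
    define q1 where "q1 = P'' (\<omega>' + \<psi> \<xi>1)"
    have "p / v' \<le> b / (v / 2)" using p v' v(4) by (intro frac_le) auto
    also have "\<dots> \<le> \<delta>" using v(3,4) \<delta>(1) by (simp add: field_simps)
    finally have small1: "\<bar>p / v'\<bar> \<le> \<delta>" using p v' by simp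
    have "p / v \<le> b / (v / 2)" using p v(4) b_pos by (intro frac_le) auto
    also have "\<dots> \<le> \<delta>" using v(3,4) \<delta>(1) by (simp add: field_simps)
    finally have small0: "\<bar>- (p / v)\<bar> \<le> \<delta>" using p v(4) by simp
    have "\<bar>q1 - P'' \<omega>'\<bar> \<le> \<eta> / (4 * b\<^sup>2)" "\<bar>q0 - P'' \<omega>'\<bar> \<le> \<eta> / (4 * b\<^sup>2)"
      unfolding q0_def q1_def using \<xi>0(1) \<xi>1(1) small0 small1 by (intro \<delta>(2); linarith)+
    then have q: "q1 - q0 \<le> \<eta> / (2 * b\<^sup>2)" by (simp add: field_simps abs_le_iff)
    have W0: "adiabatic x = p * v - d * p + q0 * p\<^sup>2 / (2 * v)"
      using v(4) by (simp add: adiabatic_def x \<xi>0(2) q0_def[symmetric] field_simps power2_eq_square)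
    have W1: "adiabatic (pp_step x) = p * v' + d * p + q1 * p\<^sup>2 / (2 * v')"
      using v' by (simp add: adiabatic_def step \<xi>1(2) q1_def[symmetric] field_simps power2_eq_square)
    \<comment> \<open>The lower-order terms agree, p * v - d * p = p * v' + d * p, because v' = v -
      2 * d.\<close>
    have "adiabatic (pp_step x) - adiabatic x = q1 * p\<^sup>2 / (2 * v') - q0 * p\<^sup>2 / (2 * v)"
      unfolding W0 W1 by (simp add: v'_def algebra_simps)
    then have "(adiabatic (pp_step x) - adiabatic x) * v = (q1 * p\<^sup>2 / (2 * v') - q0 * p\<^sup>2 / (2 * v)) * v"
      by simp
    \<comment> \<open>The first summand measures the variation of \<open>P''\<close>, the second the
      change of speed, through v / v' - 1 = 2 * d / v'.\<close>
    also have "\<dots> = p\<^sup>2 / 2 * ((q1 - q0) * (v / v') + q0 * (2 * d) / v')"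
    proof -
      have "q0 * (2 * d) / v' = q0 * v / v' - q0" using v' by (simp add: v'_def field_simps)
      then have eq: "(q1 - q0) * (v / v') + q0 * (2 * d) / v' = q1 * v / v' - q0"
        by (simp add: left_diff_distrib diff_divide_distrib)
      show ?thesis unfolding eq using v' v(4) by (simp add: field_simps)
    qed
    also have "\<dots> \<le> p\<^sup>2 / 2 * (2 * \<eta> / b\<^sup>2)"
    proof (intro mult_left_mono)
      have "(q1 - q0) * (v / v') \<le> \<eta> / (2 * b\<^sup>2) * (v / v')"
        using q v' v(4) by (intro mult_right_mono) auto
      also have "\<dots> \<le> \<eta> / (2 * b\<^sup>2) * 2"
        using v' assms by (intro mult_left_mono) (auto simp: field_simps)
      finally have 1: "(q1 - q0) * (v / v') \<le> \<eta> / b\<^sup>2" by simp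
      have "q0 * (2 * d) \<le> \<bar>q0\<bar> * (2 * \<bar>d\<bar>)" by (metis abs_ge_self abs_mult abs_numeral)
      also have "\<dots> \<le> K * (2 * M)"
        using K[of "\<omega>' + \<psi> \<xi>0"] d K0 unfolding q0_def by (intro mult_mono) auto
      finally have "q0 * (2 * d) / v' \<le> K * (2 * M) / (v / 2)"
        using v' v(4) K0 M0 by (intro frac_le) auto
      also have "\<dots> \<le> \<eta> / b\<^sup>2"
        using v(2,4) assms b_pos by (simp add: field_simps)
      finally show "(q1 - q0) * (v / v') + q0 * (2 * d) / v' \<le> 2 * \<eta> / b\<^sup>2" using 1 by simp
    qed simp
    also have "\<dots> \<le> b\<^sup>2 / 2 * (2 * \<eta> / b\<^sup>2)"
      using p assms by (intro mult_right_mono) (auto intro: power_mono)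
    also have "\<dots> = \<eta>" using b_pos by simp
    finally show "adiabatic (pp_step x) \<le> adiabatic x + \<eta> / snd x"
      using v(4) by (simp add: x field_simps)
  qed
qed

text \<open>At each phase the band is a speed interval of length e / P \<le> e / a, on which the
  weight v is at most c / a.\<close>

lemma emeasure_band_le:
  assumes "0 < c" "0 \<le> e"
  shows "emeasure liouville {x. c - e \<le> adiabatic x \<and> adiabatic x < c} \<le> ennreal (c * e / a\<^sup>2)"
proof -
  let ?B = "{x. c - e \<le> adiabatic x \<and> adiabatic x < c}"
  have "{x \<in> space phase_space. c - e \<le> adiabatic x \<and> adiabatic x < c} \<in> sets phase_space" by measurable
  then have B: "?B \<in> sets phase_space" by simp
  have "emeasure liouville ?B = (\<integral>\<^sup>+\<omega>. (\<integral>\<^sup>+v. ennreal v * indicator ?B (\<omega>, v) \<partial>lborel) \<partial>\<mu>)"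
    using B by (subst emeasure_liouville, assumption, subst lborel.nn_integral_fst[symmetric]) auto
  also have "\<dots> \<le> (\<integral>\<^sup>+\<omega>. ennreal (c * e / a\<^sup>2) \<partial>\<mu>)"
  proof (rule nn_integral_mono)
    fix \<omega>
    have "(\<integral>\<^sup>+v. ennreal v * indicator ?B (\<omega>, v) \<partial>lborel)
        \<le> (\<integral>\<^sup>+v. ennreal (c / a) * indicator {(c - e) / P \<omega>..c / P \<omega>} v \<partial>lborel)"
    proof (rule nn_integral_mono)
      fix v :: real
      show "ennreal v * indicator ?B (\<omega>, v) \<le> ennreal (c / a) * indicator {(c - e) / P \<omega>..c / P \<omega>} v"
      proof (cases "(\<omega>, v) \<in> ?B")
        case True
        then have v: "(c - e) / P \<omega> \<le> v" "v \<le> c / P \<omega>"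
          using P_pos[of \<omega>] by (auto simp: adiabatic_def field_simps)
        have "c / P \<omega> \<le> c / a" using assms a_pos P_ge by (intro divide_left_mono) (auto simp: P_pos)
        with v(2) have "ennreal v \<le> ennreal (c / a)" by (intro ennreal_leI) (rule order_trans)
        with v True show ?thesis by simp
      qed simp
    qed
    also have "\<dots> = ennreal (c / a) * ennreal (c / P \<omega> - (c - e) / P \<omega>)"
      using assms P_pos[of \<omega>] by (subst nn_integral_cmult_indicator) (auto simp: divide_right_mono)
    also have "\<dots> = ennreal (c / a * (e / P \<omega>))"
      using assms a_pos P_pos[of \<omega>] by (subst ennreal_mult[symmetric]) (auto simp: diff_divide_distrib[symmetric])
    also have "\<dots> \<le> ennreal (c / a * (e / a))"
      using assms a_pos P_ge[of \<omega>] by (intro ennreal_leI mult_left_mono divide_left_mono) (auto simp: P_pos)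
    finally show "(\<integral>\<^sup>+v. ennreal v * indicator ?B (\<omega>, v) \<partial>lborel) \<le> ennreal (c * e / a\<^sup>2)"
      by (simp add: power2_eq_square)
  qed
  also have "\<dots> = ennreal (c * e / a\<^sup>2)" using emeasure_space_1 by simp
  finally show ?thesis .
qed

section \<open>Escaping orbits\<close>

lemma iterate_meas [measurable]: "(pp_step ^^ n) \<in> phase_space \<rightarrow>\<^sub>M phase_space"
  by (induction n) (auto intro!: measurable_comp)

lemma escape_sets [measurable]: "escape c \<in> sets phase_space"
proof -
  \<comment> \<open>Integer levels reduce divergence to countably many conditions.\<close>
  have lim: "filterlim f at_top sequentially \<longleftrightarrow> (\<forall>k::nat. \<exists>N. \<forall>n\<ge>N. real k \<le> f n)" for f :: "nat \<Rightarrow> real"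
  proof
    assume *: "\<forall>k::nat. \<exists>N. \<forall>n\<ge>N. real k \<le> f n"
    show "filterlim f at_top sequentially"
      unfolding filterlim_at_top eventually_sequentially
    proof
      fix Z :: real
      obtain k :: nat where "Z \<le> real k" using real_arch_simple by blast
      moreover obtain N where "\<forall>n\<ge>N. real k \<le> f n" using * by blast
      ultimately show "\<exists>N. \<forall>n\<ge>N. Z \<le> f n" by (meson order_trans)
    qed
  qed (simp add: filterlim_at_top eventually_sequentially)
  have "{x \<in> space phase_space. (\<forall>n. c < snd ((pp_step ^^ n) x)) \<and>
      (\<forall>k::nat. \<exists>N. \<forall>n\<ge>N. real k \<le> snd ((pp_step ^^ n) x))} \<in> sets phase_space"
    by measurable
  then show ?thesis unfolding escape_def lim by simp
qed

lemma escape_gt: "x \<in> escape c \<Longrightarrow> c < snd x"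
  unfolding escape_def by (metis (mono_tags, lifting) funpow_0 mem_Collect_eq)

lemma escape_pp_step: "x \<in> escape c \<Longrightarrow> pp_step x \<in> escape c"
proof -
  assume x: "x \<in> escape c"
  have eq: "(pp_step ^^ n) (pp_step x) = (pp_step ^^ Suc n) x" for n by (simp add: funpow_swap1)
  have "filterlim (\<lambda>n. snd ((pp_step ^^ Suc n) x)) at_top sequentially"
    using x filterlim_sequentially_Suc[of "\<lambda>n. snd ((pp_step ^^ n) x)"] unfolding escape_def by blast
  moreover have "c < snd ((pp_step ^^ Suc n) x)" for n using x unfolding escape_def by blast
  ultimately show ?thesis unfolding escape_def mem_Collect_eq eq by blast
qed

lemma escape_iterate: "x \<in> escape c \<Longrightarrow> (pp_step ^^ n) x \<in> escape c"
  by (induction n) (auto intro: escape_pp_step)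

lemma adiabatic_at_top:
  assumes "x \<in> escape c" "0 \<le> c"
  shows "filterlim (\<lambda>n. adiabatic ((pp_step ^^ n) x)) at_top sequentially"
proof (rule filterlim_at_top_mono)
  have "filterlim (\<lambda>n. snd ((pp_step ^^ n) x)) at_top sequentially" using assms by (simp add: escape_def)
  then show "filterlim (\<lambda>n. a * snd ((pp_step ^^ n) x)) at_top sequentially"
    by (intro filterlim_tendsto_pos_mult_at_top[OF tendsto_const a_pos])
  show "\<forall>\<^sub>F n in sequentially. a * snd ((pp_step ^^ n) x) \<le> adiabatic ((pp_step ^^ n) x)"
  proof (intro always_eventually allI)
    fix n
    have "0 \<le> snd ((pp_step ^^ n) x)" using escape_gt[OF escape_iterate[OF assms(1)]] assms(2) by (meson less_imp_le order_trans)
    then show "a * snd ((pp_step ^^ n) x) \<le> adiabatic ((pp_step ^^ n) x)"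
      unfolding adiabatic_def using P_ge by (intro mult_right_mono) auto
  qed
qed

text \<open>Natural levels keep the family countable, and the speed threshold keeps it where
  preimages do not gain measure.\<close>

definition last_visit :: "nat \<Rightarrow> ('a \<times> real) set" where
  "last_visit k = {x \<in> escape (2 * speed_bound). adiabatic x \<le> real k \<and>
     (\<forall>n>0. real k < adiabatic ((pp_step ^^ n) x))}"

lemma two_speed_bound_nonneg: "0 \<le> 2 * speed_bound"
  using v_star_nonneg v_star_le by linarith

lemma last_visit_sets [measurable]: "last_visit k \<in> sets phase_space"
proof -
  have "last_visit k = {x \<in> space phase_space. x \<in> escape (2 * speed_bound) \<and> adiabatic x \<le> real k \<and>
     (\<forall>n. n > 0 \<longrightarrow> real k < adiabatic ((pp_step ^^ n) x))}"
    by (auto simp: last_visit_def)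
  also have "\<dots> \<in> sets phase_space" by measurable
  finally show ?thesis .
qed

lemma emeasure_last_visit: "emeasure liouville (last_visit k) = 0"
proof -
  have "emeasure liouville (last_visit k) \<le> 0 + ennreal e" if "0 < e" for e
  proof -
    \<comment> \<open>Solves c * (2 * b * \<eta> / c) / a^2 = e; the level c cancels, so \<eta> can
      be fixed before c.\<close>
    define \<eta> where "\<eta> = e * a\<^sup>2 / (2 * b)"
    have \<eta>: "0 < \<eta>" using that a_pos b_pos by (simp add: \<eta>_def)
    obtain V where V: "\<And>x. V \<le> snd x \<Longrightarrow> adiabatic (pp_step x) \<le> adiabatic x + \<eta> / snd x"
      using adiabatic_step_le[OF \<eta>] by blast
    \<comment> \<open>On \<open>B\<close> below, c \<le> 2 * b * v, so c \<ge> 2 * b * V forces v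
      \<ge> V; and c > k places the crossing above the last visit.\<close>
    define c where "c = max (2 * b * V) (real k + 1)"
    have c: "2 * b * V \<le> c" "real k < c" "0 < c" by (auto simp: c_def)
    \<comment> \<open>The points about to cross the level c upwards.\<close>
    define B where "B = {x \<in> escape (2 * speed_bound). adiabatic x < c \<and> c \<le> adiabatic (pp_step x)}"
    have B[measurable]: "B \<in> sets phase_space"
    proof -
      have "B = {x \<in> space phase_space. x \<in> escape (2 * speed_bound) \<and> adiabatic x < c \<and> c \<le> adiabatic (pp_step x)}"
        by (auto simp: B_def)
      also have "\<dots> \<in> sets phase_space" by measurable
      finally show ?thesis .
    qed
    have "emeasure liouville (last_visit k) \<le> emeasure liouville B"
    proof (rule emeasure_wandering_le[where F=pp_step and E="escape (2 * speed_bound)"])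
      show "pp_step \<in> liouville \<rightarrow>\<^sub>M liouville" by measurable
      show "emeasure liouville (escape (2 * speed_bound) \<inter> pp_step -` A) \<le> emeasure liouville A"
        if "A \<in> sets liouville" "A \<subseteq> escape (2 * speed_bound)" for A
      proof (rule emeasure_pp_step_vimage_le)
        show "2 * speed_bound < snd x" if "x \<in> A" for x
          using that \<open>A \<subseteq> _\<close> by (intro escape_gt) blast
        show "v_star < snd x" if "x \<in> escape (2 * speed_bound)" for x
          using escape_gt[OF that] v_star_le by linarith
      qed (use that in \<open>simp only: sets_liouville\<close>, rule escape_sets)
      show "(pp_step ^^ n) x \<notin> last_visit k" if "x \<in> last_visit k" "0 < n" for x n
      proof -
        have "real k < adiabatic ((pp_step ^^ n) x)" using that unfolding last_visit_def by blast
        then show ?thesis unfolding last_visit_def by auto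
      qed
      fix x assume x: "x \<in> last_visit k"
      then have esc: "x \<in> escape (2 * speed_bound)" and low: "adiabatic x \<le> real k"
        by (auto simp: last_visit_def)
      have "\<exists>m. c \<le> adiabatic ((pp_step ^^ m) x)"
        using adiabatic_at_top[OF esc two_speed_bound_nonneg]
        unfolding filterlim_at_top eventually_sequentially by blast
      then obtain m where m: "c \<le> adiabatic ((pp_step ^^ m) x)" "\<And>i. i < m \<Longrightarrow> adiabatic ((pp_step ^^ i) x) < c"
        using LeastI_ex[of "\<lambda>m. c \<le> adiabatic ((pp_step ^^ m) x)"] not_less_Least not_le by metis
      \<comment> \<open>The first time at or above c is not 0, since the start has level at most k <
        c; the point just before it lies in \<open>B\<close>.\<close>
      then obtain n where n: "m = Suc n" using low c by (cases m) auto
      have "(pp_step ^^ n) x \<in> B" using m n escape_iterate[OF esc] by (simp add: B_def)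
      then show "\<exists>n. (pp_step ^^ n) x \<in> B" by blast
    next
      show "last_visit k \<subseteq> escape (2 * speed_bound)" unfolding last_visit_def by blast
      show "B \<subseteq> escape (2 * speed_bound)" unfolding B_def by blast
    qed (simp_all only: sets_liouville escape_sets last_visit_sets B escape_pp_step)
    also have "emeasure liouville B \<le> emeasure liouville {x. c - 2 * b * \<eta> / c \<le> adiabatic x \<and> adiabatic x < c}"
    proof (rule emeasure_mono)
      have "{x \<in> space phase_space. c - 2 * b * \<eta> / c \<le> adiabatic x \<and> adiabatic x < c} \<in> sets phase_space"
        by measurable
      then show "{x. c - 2 * b * \<eta> / c \<le> adiabatic x \<and> adiabatic x < c} \<in> sets liouville" by simp
      show "B \<subseteq> {x. c - 2 * b * \<eta> / c \<le> adiabatic x \<and> adiabatic x < c}"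
      proof
        fix x assume "x \<in> B"
        then have x: "x \<in> escape (2 * speed_bound)" "adiabatic x < c" "c \<le> adiabatic (pp_step x)"
          by (auto simp: B_def)
        have v: "2 * speed_bound < snd x" "0 < snd (pp_step x)"
          using escape_gt[OF x(1)] escape_gt[OF escape_pp_step[OF x(1)]] two_speed_bound_nonneg by auto
        have "v_star < snd x" using v(1) v_star_le by linarith
        then obtain \<omega>' where "snd (pp_step x) = snd x - 2 * P' \<omega>'"
          by (cases x) (simp add: pp_step_def Let_def)
        then have v2: "snd (pp_step x) \<le> 2 * snd x" using P'_bounds(1)[of \<omega>'] v(1) by linarith
        have "c \<le> b * snd (pp_step x)"
          using x(3) mult_right_mono[OF P_le, of "snd (pp_step x)" "fst (pp_step x)"] v(2)
          unfolding adiabatic_def by linarith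
        also have "\<dots> \<le> b * (2 * snd x)" using v2 b_pos by (intro mult_left_mono) auto
        finally have cv: "c \<le> 2 * b * snd x" by simp
        then have "V \<le> snd x" using c(1) b_pos by (smt (verit) mult_le_cancel_left_pos)
        from V[OF this] x(3) have "c \<le> adiabatic x + \<eta> / snd x" by linarith
        moreover have "\<eta> / snd x \<le> \<eta> / (c / (2 * b))"
          using cv c(3) b_pos \<eta> by (intro frac_le) (auto simp: field_simps)
        moreover have "\<eta> / (c / (2 * b)) = 2 * b * \<eta> / c" by simp
        ultimately show "x \<in> {x. c - 2 * b * \<eta> / c \<le> adiabatic x \<and> adiabatic x < c}"
          using x(2) by (intro CollectI conjI) linarith+
      qed
    qed
    also have "\<dots> \<le> ennreal (c * (2 * b * \<eta> / c) / a\<^sup>2)"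
      using c(3) b_pos \<eta> by (intro emeasure_band_le) auto
    also have "c * (2 * b * \<eta> / c) / a\<^sup>2 = e" using c(3) a_pos b_pos by (simp add: \<eta>_def)
    finally show ?thesis by simp
  qed
  then show ?thesis by (metis ennreal_le_epsilon le_zero_eq)
qed

text \<open>Orbits in \<open>escape v_star\<close> meet the speed conditions of
  \<open>null_sets_pp_step_vimage\<close> at every step, so null sets can be pulled back one step at
  a time.\<close>

lemma null_sets_iterate_vimage:
  assumes N: "N \<in> null_sets phase_space"
  shows "{x \<in> escape v_star. (pp_step ^^ n) x \<in> N} \<in> null_sets phase_space"
proof (induction n)
  case 0
  have "escape v_star \<inter> N \<in> null_sets phase_space" by (rule null_set_Int1[OF N escape_sets])
  then show ?case by (simp add: Int_def)
next
  case (Suc n)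
  have [measurable]: "N \<in> sets phase_space" using N by auto
  have "{x \<in> space phase_space. x \<in> escape v_star \<and> (pp_step ^^ Suc n) x \<in> N} \<in> sets phase_space"
    by measurable
  then have "{x \<in> escape v_star. (pp_step ^^ Suc n) x \<in> N} \<in> sets phase_space" by simp
  moreover have "{x \<in> escape v_star. (pp_step ^^ Suc n) x \<in> N} \<subseteq> {x. v_star < snd x \<and>
      v_star < snd (pp_step x) \<and> pp_step x \<in> {x \<in> escape v_star. (pp_step ^^ n) x \<in> N}}"
    by (auto simp: funpow_swap1 simp del: split_paired_All intro: escape_pp_step escape_gt)
  ultimately show ?case using null_sets_subset[OF null_sets_pp_step_vimage[OF Suc]] by blast
qed

lemma escape_null: "escape v_star \<in> null_sets phase_space"
proof -
  have last: "last_visit k \<in> null_sets phase_space" for k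
  proof -
    have "last_visit k \<in> null_sets liouville" 
      by (rule null_setsI[OF emeasure_last_visit]) (simp only: sets_liouville last_visit_sets)
    moreover have "0 < snd x" if "x \<in> last_visit k" for x
      using that escape_gt[of x "2 * speed_bound"] two_speed_bound_nonneg by (auto simp: last_visit_def)
    ultimately show ?thesis using null_sets_liouville_iff[of "last_visit k"] by auto
  qed
  have "escape v_star \<subseteq> (\<Union>k n. {x \<in> escape v_star. (pp_step ^^ n) x \<in> last_visit k})"
  proof
    fix x assume x: "x \<in> escape v_star"
    then obtain N where N: "\<And>n. n \<ge> N \<Longrightarrow> 2 * speed_bound + 1 \<le> snd ((pp_step ^^ n) x)"
      unfolding escape_def filterlim_at_top eventually_sequentially by blast
    define W where "W n = adiabatic ((pp_step ^^ n) x)" for n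
    have W: "filterlim W at_top sequentially"
      unfolding W_def by (rule adiabatic_at_top[OF x v_star_nonneg])
    \<comment> \<open>With this k the time N itself counts as a visit, so the last visit comes at N
      or later, when the orbit stays above \<open>2 * speed_bound\<close>.\<close>
    obtain k :: nat where k: "W N \<le> real k" using real_arch_simple by blast
    obtain N' where N': "\<And>n. n \<ge> N' \<Longrightarrow> real k + 1 \<le> W n"
      using W unfolding filterlim_at_top eventually_sequentially by blast
    define n where "n = Max {n. W n \<le> real k}"
    have "{n. W n \<le> real k} \<subseteq> {..N'}"
    proof
      fix n assume "n \<in> {n. W n \<le> real k}"
      then show "n \<in> {..N'}" using N'[of n] by (cases "N' \<le> n") auto
    qed
    then have fin: "finite {n. W n \<le> real k}" by (rule finite_subset) simp
    have n: "W n \<le> real k" using Max_in[OF fin] k unfolding n_def by auto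
    have "N \<le> n" unfolding n_def using fin k by (intro Max_ge) auto
    have above: "real k < W m" if "n < m" for m
    proof (rule ccontr)
      assume "\<not> real k < W m"
      then have "m \<le> n" unfolding n_def using fin by (intro Max_ge) auto
      with that show False by simp
    qed
    have iter: "(pp_step ^^ i) ((pp_step ^^ n) x) = (pp_step ^^ (i + n)) x" for i by (simp add: funpow_add)
    have "(pp_step ^^ n) x \<in> escape (2 * speed_bound)"
    proof -
      have "2 * speed_bound < snd ((pp_step ^^ i) ((pp_step ^^ n) x))" for i
        using N[of "i + n"] \<open>N \<le> n\<close> unfolding iter by simp
      moreover have "filterlim (\<lambda>i. snd ((pp_step ^^ i) ((pp_step ^^ n) x))) at_top sequentially"
        using escape_iterate[OF x, of n] by (simp add: escape_def)
      ultimately show ?thesis by (simp add: escape_def)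
    qed
    then have "(pp_step ^^ n) x \<in> last_visit k"
      using n above by (auto simp: last_visit_def iter W_def)
    with x show "x \<in> (\<Union>k n. {x \<in> escape v_star. (pp_step ^^ n) x \<in> last_visit k})" by blast
  qed
  moreover have "(\<Union>k n. {x \<in> escape v_star. (pp_step ^^ n) x \<in> last_visit k}) \<in> null_sets phase_space"
    by (intro null_sets_UN null_sets_iterate_vimage last)
  ultimately show ?thesis using null_sets_subset escape_sets by blast
qed

text \<open>For fixed (t, v), translation by \<psi> t shows that the set of phases \<omega> for
  which (t, v) escapes has a measure independent of t. Fubini on the product of the group with the
  plane then brings in \<open>escape_null\<close>.\<close>

lemma AE_escaping_set_null: "AE \<omega> in \<mu>. escaping_set (forcing \<omega>) v_star \<in> null_sets lebesgue"
proof -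
  let ?N = "escape v_star"
  interpret mu_plane: pair_sigma_finite \<mu> "lborel :: (real \<times> real) measure" ..
  define f where "f \<omega> y = (indicator ?N (\<omega> + \<psi> (fst y), snd y) :: ennreal)" for \<omega> and y :: "real \<times> real"
  have f[measurable]: "(\<lambda>z. f (fst z) (snd z)) \<in> borel_measurable (\<mu> \<Otimes>\<^sub>M lborel)"
  proof -
    have "(\<lambda>z. (fst z + \<psi> (fst (snd z)), snd (snd z))) \<in> \<mu> \<Otimes>\<^sub>M (borel :: (real \<times> real) measure) \<rightarrow>\<^sub>M phase_space"
      by (subst borel_prod[symmetric]) measurable
    from measurable_compose[OF this borel_measurable_indicator[OF escape_sets[of v_star]]]
    have "(\<lambda>z. f (fst z) (snd z)) \<in> borel_measurable (\<mu> \<Otimes>\<^sub>M (borel :: (real \<times> real) measure))"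
      unfolding f_def by simp
    then show ?thesis by (simp cong: measurable_cong_sets sets_pair_measure_cong)
  qed
  have "(\<integral>\<^sup>+\<omega>. (\<integral>\<^sup>+y. f \<omega> y \<partial>lborel) \<partial>\<mu>) = (\<integral>\<^sup>+y. (\<integral>\<^sup>+\<omega>. f \<omega> y \<partial>\<mu>) \<partial>lborel)"
    by (rule mu_plane.Fubini'[symmetric]) (simp add: split_beta')
  also have "\<dots> = (\<integral>\<^sup>+y. (\<integral>\<^sup>+\<omega>. indicator ?N (\<omega>, snd y) \<partial>\<mu>) \<partial>(lborel :: (real \<times> real) measure))"
  proof (rule nn_integral_cong)
    fix y :: "real \<times> real"
    have "(\<lambda>\<omega>. indicator ?N (\<omega>, snd y) :: ennreal) \<in> borel_measurable borel" by measurable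
    from nn_integral_translate[OF this, of "\<psi> (fst y)"]
    show "(\<integral>\<^sup>+\<omega>. f \<omega> y \<partial>\<mu>) = (\<integral>\<^sup>+\<omega>. indicator ?N (\<omega>, snd y) \<partial>\<mu>)" by (simp add: f_def)
  qed
  also have "\<dots> = (\<integral>\<^sup>+y. (\<integral>\<^sup>+\<omega>. indicator ?N (\<omega>, snd y) \<partial>\<mu>) \<partial>((lborel :: real measure) \<Otimes>\<^sub>M lborel))"
    by (simp add: lborel_prod)
  also have "\<dots> = (\<integral>\<^sup>+t. (\<integral>\<^sup>+v. (\<integral>\<^sup>+\<omega>. indicator ?N (\<omega>, v) \<partial>\<mu>) \<partial>lborel) \<partial>(lborel :: real measure))"
    by (subst lborel.nn_integral_fst[symmetric]) auto
  also have "(\<integral>\<^sup>+v. (\<integral>\<^sup>+\<omega>. indicator ?N (\<omega>, v) \<partial>\<mu>) \<partial>lborel) = (\<integral>\<^sup>+x. indicator ?N x \<partial>phase_space)"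
    by (rule mu_lborel.nn_integral_snd) measurable
  \<comment> \<open>The integrand in t vanishes, so integrating over the infinite time axis still
    gives 0.\<close>
  also have "\<dots> = 0"
    by (simp only: nn_integral_indicator[OF escape_sets] null_setsD1[OF escape_null])
  finally have "(\<integral>\<^sup>+\<omega>. (\<integral>\<^sup>+y. f \<omega> y \<partial>lborel) \<partial>\<mu>) = 0" by simp
  moreover have "(\<lambda>\<omega>. \<integral>\<^sup>+y. f \<omega> y \<partial>lborel) \<in> borel_measurable \<mu>"
    by (rule lborel.borel_measurable_nn_integral) (simp add: split_beta')
  ultimately have "AE \<omega> in \<mu>. (\<integral>\<^sup>+y. f \<omega> y \<partial>lborel) = 0"
    by (simp only: nn_integral_0_iff_AE)
  then show ?thesis
  proof eventually_elim
    fix \<omega> assume 0: "(\<integral>\<^sup>+y. f \<omega> y \<partial>lborel) = 0"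
    have f\<omega>: "f \<omega> = indicator (escaping_set (forcing \<omega>) v_star)"
      by (auto simp: f_def escaping_set_eq indicator_def fun_eq_iff)
    have "f \<omega> \<in> borel_measurable lborel"
      using measurable_compose[OF measurable_Pair1' f, of \<omega>] by simp
    then have S: "escaping_set (forcing \<omega>) v_star \<in> sets lborel"
      unfolding f\<omega> by (simp add: borel_measurable_indicator_iff)
    with 0 have "emeasure lborel (escaping_set (forcing \<omega>) v_star) = 0" unfolding f\<omega> by simp
    with S have "escaping_set (forcing \<omega>) v_star \<in> null_sets lborel" by blast
    then show "escaping_set (forcing \<omega>) v_star \<in> null_sets lebesgue" by (rule null_sets_completionI)
  qed
qed

end

theorem theorem5p1:
  fixes \<psi> :: "real \<Rightarrow> 'a::{topological_ab_group_add, metric_space}"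
    and \<mu> :: "'a measure"
    and P :: "'a \<Rightarrow> real"
    and a b :: real
  assumes compact_Omega: "compact (UNIV :: 'a set)"
    and psi_cont: "continuous_on UNIV \<psi>"
    and psi_hom: "\<And>s t. \<psi> (s + t) = \<psi> s + \<psi> t"
    and psi_dense: "closure (range \<psi>) = UNIV"
    and haar: "haar_prob \<mu>"
    and ab: "0 < a" "a < b"
    and P_C2: "C2_psi \<psi> P"
    and P_bounds: "\<And>\<omega>. a \<le> P \<omega> \<and> P \<omega> \<le> b"
  shows "AE \<omega> in \<mu>.
           escaping_set (\<lambda>t. P (\<omega> + \<psi> t))
                        (2 * max (Sup (range (dpsi \<psi> P))) 0) \<in> null_sets lebesgue"
proof -
  interpret ping_pong \<psi> \<mu> P a b
    using assms by unfold_locales auto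
  show ?thesis
    using AE_escaping_set_null unfolding v_star_def .
qed

end
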